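(* The Coughlan family of Godeaux surfaces with $\pi_1=\mathbb{Z}/2$, where each member $X=Y/\sigma$ is a $\mathbb{Z}/2$-quotient of a hyperelliptic surface $Y$ with $K_Y^2=2$, $p_g(Y)=1$, $q(Y)=0$, is determined by $7$ parameters. That is, although the family is a priori described by the $8$ parameters consisting of $(\alpha,l_1,l_2,l_3,l_4)\in\mathbb{C}^5$, $l\in\mathbb{C}^*$ and a point $[h]$ of a projective plane, every member is isomorphic to a member with $l=1$, so that the family is parametrized by $(\alpha,l_1,l_2,l_3,l_4)$ together with $[h]\in\mathbb{P}^2$.
   Context: **Coughlan's family.** Let $\alpha,l_1,l_2,l_3,l_4\in\mathbb{C}$ and $l\in\mathbb{C}^*$ be parameters (general enough that the objects below exist). Let $R=\mathbb{C}[x,y_1,y_2,y_3,z_1,z_2]$ be graded with $\deg x=1$, $\deg y_i=2$, $\deg z_i=3$, so that $\operatorname{Proj}R=\mathbb{P}(1,2^3,3^2)$, and let $\mathbb{C}[x,u,v]$ be graded with all variables of degree $1$. Put $f=y_1+\alpha y_3$ and $g=\alpha y_1+y_3$. Let $\Phi\colon\mathbb{P}^2\to\mathbb{P}(1,2^3,3^2)$ be given by the graded homomorphism $\Phi^*\colon R\to\mathbb{C}[x,u,v]$: $$\Phi^*(x)=x,\quad \Phi^*(y_1)=u^2+2xv,\quad \Phi^*(y_2)=l\,x(u-v),\quad \Phi^*(y_3)=v^2+2xu,$$ $$\Phi^*(z_1)=u\big(\Phi^*(f)+\alpha(1+\alpha)x^2\big)+(1-\alpha^2)xuv-\alpha(1-\alpha^2)x^2v,$$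 $$\Phi^*(z_2)=v\big(\Phi^*(g)+\alpha(1+\alpha)x^2\big)+(1-\alpha^2)xuv-\alpha(1-\alpha^2)x^2u.$$ Let $\Gamma$ be the image of $\Phi$ and $I_\Gamma=\ker\Phi^*$. The $R$-module $\mathbb{C}[x,u,v]$ is generated by $1,u,v,uv$. The degree $6$ part of $I_\Gamma$ is spanned by six polynomials $C_1,C_2,Q_1,Q_2,Q_3,Q_4$ which are congruent modulo $x$ to, respectively, $$z_1^2-y_1f^2,\quad z_2^2-y_3g^2,\quad fy_2^2,\quad y_2^3,\quad gy_2^2,\quad fgy_2.$$ Let $W'_{6,6}\subset\mathbb{P}(1,2^3,3^2)$ be the complete intersection $F=G=0$ with $$F=C_1+l_1Q_1+l_2Q_2+l_3Q_3+l_4Q_4,\qquad G=C_2+l_3Q_1-l_2Q_2+l_1Q_3-l_4Q_4,$$ let $A=R/(F,G)$, with $\omega_A\cong A(-1)$, and let $I=I_\Gamma/(F,G)\subset A$. *Unprojection.* From the exact sequence $0\to\omega_A\to\operatorname{Hom}_A(I,\omega_A)\to\omega_\Gamma\to0$ and the identification $\omega_\Gamma=\omega_{\mathbb{C}[x,u,v]}\cong\mathbb{C}[x,u,v](-3)$, choose homogeneous elements $y_4,z_3,z_4,t$ of $\operatorname{Hom}_A(I,A)$, of degrees $2,3,3,4$, mapping to $1,u,v,uv$ respectively. Regard them as elements of the fraction field of $A$ (a homomorphism $I\to A$ is multiplication by a rational function). Let $W=\operatorname{Proj}A[y_4,z_3,z_4,t]\subset\mathbb{P}(1,2^4,3^4,4)$;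 this is independent of the choice of lifts, and $R(W,-K_W)=A[y_4,z_3,z_4,t]$. *Involution.* The involution $\sigma$ of $W$ is induced by $x\mapsto-x$, $y_1\leftrightarrow y_3$, $y_2\mapsto-y_2$, $z_1\mapsto-z_2$, $z_2\mapsto-z_1$ (equivalently, up to the action of $-1$ on the weighted projective space, $x\mapsto x$, $y_1\leftrightarrow y_3$, $y_2\mapsto -y_2$, $z_1\leftrightarrow z_2$). With suitable choices of lifts, it acts by $y_4\mapsto-y_4$, $z_3\leftrightarrow z_4$, $t\mapsto-t$. The $(-1)$-eigenspace $H^0(W,-2K_W)^-$ of $\sigma$ in degree $2$ is $3$-dimensional, spanned by $y_1-y_3,\ y_2,\ y_4$. *Members.* For a nonzero $h\in H^0(W,-2K_W)^-$ let $Y=\{h=0\}\subset W$, so that $R(Y,K_Y)=R(W,-K_W)/(h)$. The members of Coughlan's family are the surfaces $Y$ so obtained which are (canonical models of) surfaces of general type with $p_g=1$, $q=0$, $K^2=2$ and on which $\sigma$ acts freely. The corresponding family of $\mathbb{Z}/2$-Godeaux surfaces consists of the quotients $X=Y/\sigma$. The surface $Y$ is called hyperelliptic because its canonical curve is hyperelliptic. *)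

theory Defs
  imports
    "HOL-Analysis.Abstract_Topology"
    "HOL-Algebra.QuotRing"
    "HOL-Algebra.Generated_Rings"
    "HOL-Algebra.Algebraic_Closure_Type"
    "HOL-Computational_Algebra.Formal_Power_Series"
    "HOL-Library.Poly_Mapping"
    "HOL-Library.FuncSet"
begin

section \<open>Complex varieties as spaces with functions\<close>

text \<open>
  A variety over the complex numbers is represented by its closed points, with the Zariski
  topology, and for each open set the complex-valued functions regular on it. A function is a
  total function on the type of points; only its values on the open set in question matter.
\<close>

record 'p variety =
  vtop :: "'p topology"
  vreg :: "'p set \<Rightarrow> ('p \<Rightarrow> complex) set"

definition isomorphic_varieties :: "'p variety \<Rightarrow> 'q variety \<Rightarrow> bool" where
  "isomorphic_varieties V W \<longleftrightarrow>
     (\<exists>e. homeomorphic_map (vtop V) (vtop W) e \<and>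
        (\<forall>U f. openin (vtop W) U \<longrightarrow>
           (f \<in> vreg W U \<longleftrightarrow> f \<circ> e \<in> vreg V {P \<in> topspace (vtop V). e P \<in> U})))"

definition closed_subvariety :: "'p variety \<Rightarrow> 'p set \<Rightarrow> 'p variety" where
  "closed_subvariety V Z =
     \<lparr>vtop = subtopology (vtop V) Z,
      vreg = (\<lambda>U. {f. \<forall>P\<in>U. \<exists>W g. openin (vtop V) W \<and> P \<in> W \<and> g \<in> vreg V W \<and>
                          (\<forall>Q\<in>W \<inter> Z. Q \<in> U \<and> f Q = g Q)})\<rparr>"

text \<open>
  Geometric quotient by an involution \<open>s\<close>: the points are the orbits, and a function is regular
  if its pullback is.
\<close>

definition quotient_variety :: "'p variety \<Rightarrow> ('p \<Rightarrow> 'p) \<Rightarrow> 'p set variety" where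
  "quotient_variety V s =
     \<lparr>vtop = topology (\<lambda>U. U \<subseteq> (\<lambda>P. {P, s P}) ` topspace (vtop V) \<and>
                           openin (vtop V) {P \<in> topspace (vtop V). {P, s P} \<in> U}),
      vreg = (\<lambda>U. {f. (\<lambda>P. f {P, s P}) \<in> vreg V {P \<in> topspace (vtop V). {P, s P} \<in> U}})\<rparr>"

definition irreducible_variety :: "'p variety \<Rightarrow> bool" where
  "irreducible_variety V \<longleftrightarrow> topspace (vtop V) \<noteq> {} \<and>
     (\<forall>U U'. openin (vtop V) U \<and> openin (vtop V) U' \<and> U \<noteq> {} \<and> U' \<noteq> {} \<longrightarrow> U \<inter> U' \<noteq> {})"

subsection \<open>Local rings and Du Val singularities\<close>

text \<open>Representatives of germs; two of them define the same germ if they agree near \<open>p\<close>.\<close>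

definition local_functions :: "'p variety \<Rightarrow> 'p \<Rightarrow> ('p \<Rightarrow> complex) set" where
  "local_functions V p = {f. \<exists>U. openin (vtop V) U \<and> p \<in> U \<and> f \<in> vreg V U}"

text \<open>The power \<open>\<mm>\<^sub>p\<^sup>n\<close> of the maximal ideal of the local ring at \<open>p\<close>.\<close>

inductive_set max_ideal_power :: "'p variety \<Rightarrow> 'p \<Rightarrow> nat \<Rightarrow> ('p \<Rightarrow> complex) set"
  for V :: "'p variety" and p :: 'p and n :: nat where
  prod: "\<lbrakk>g \<in> local_functions V p; \<forall>i<n. f i \<in> local_functions V p \<and> f i p = 0\<rbrakk>
           \<Longrightarrow> (\<lambda>q. g q * (\<Prod>i<n. f i q)) \<in> max_ideal_power V p n"
| add: "\<lbrakk>f \<in> max_ideal_power V p n; g \<in> max_ideal_power V p n\<rbrakk>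
           \<Longrightarrow> (\<lambda>q. f q + g q) \<in> max_ideal_power V p n"
| germ: "\<lbrakk>f \<in> max_ideal_power V p n; openin (vtop V) U; p \<in> U; \<forall>q\<in>U. g q = f q\<rbrakk>
           \<Longrightarrow> g \<in> max_ideal_power V p n"

text \<open>Formal power series in three variables are the iterated type \<open>complex fps fps fps\<close>.\<close>

type_synonym fps3 = "complex fps fps fps"

definition fps3_x :: fps3 where "fps3_x = fps_const (fps_const fps_X)"
definition fps3_y :: fps3 where "fps3_y = fps_const fps_X"
definition fps3_z :: fps3 where "fps3_z = fps_X"

definition fps3_order_ge :: "nat \<Rightarrow> fps3 \<Rightarrow> bool" where
  "fps3_order_ge n g \<longleftrightarrow> (\<forall>i j k. i + j + k < n \<longrightarrow> fps_nth (fps_nth (fps_nth g i) j) k = 0)"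

text \<open>
  The completion of the local ring at \<open>p\<close> is \<open>\<complex>[[x,y,z]]/(E)\<close>: there is a homomorphism \<open>\<theta>\<close> of
  \<open>\<complex>\<close>-algebras from the local ring to \<open>\<complex>[[x,y,z]]/(E)\<close> (on representatives) that induces
  isomorphisms modulo the \<open>n\<close>-th powers of the maximal ideals, for every \<open>n\<close>.
\<close>

definition completion_is_hypersurface :: "'p variety \<Rightarrow> 'p \<Rightarrow> fps3 \<Rightarrow> bool" where
  "completion_is_hypersurface V p E \<longleftrightarrow>
     (\<exists>\<theta>. (\<forall>f\<in>local_functions V p. \<forall>g\<in>local_functions V p.
              E dvd \<theta> (\<lambda>q. f q + g q) - (\<theta> f + \<theta> g) \<and>
              E dvd \<theta> (\<lambda>q. f q * g q) - \<theta> f * \<theta> g) \<and>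
          (\<forall>c. E dvd \<theta> (\<lambda>q. c) - fps_const (fps_const (fps_const c))) \<and>
          (\<forall>n. \<forall>f\<in>local_functions V p.
              (\<exists>a. fps3_order_ge n (\<theta> f - a * E)) \<longleftrightarrow> f \<in> max_ideal_power V p n) \<and>
          (\<forall>n g. \<exists>f\<in>local_functions V p. \<exists>a. fps3_order_ge n (\<theta> f - g - a * E)))"

text \<open>
  Equations of types \<open>A\<^sub>n\<close>, \<open>D\<^sub>n\<close>, \<open>E\<^sub>6\<close>, \<open>E\<^sub>7\<close>, \<open>E\<^sub>8\<close>. The case \<open>n = 0\<close> of the first set is a smooth
  point.
\<close>

definition du_val_equations :: "fps3 set" where
  "du_val_equations =
     {fps3_x ^ 2 + fps3_y ^ 2 + fps3_z ^ (n + 1) | n. True} \<union>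
     {fps3_x ^ 2 + fps3_y ^ 2 * fps3_z + fps3_z ^ (n - 1) | n. 4 \<le> n} \<union>
     {fps3_x ^ 2 + fps3_y ^ 3 + fps3_z ^ 4,
      fps3_x ^ 2 + fps3_y ^ 3 + fps3_y * fps3_z ^ 3,
      fps3_x ^ 2 + fps3_y ^ 3 + fps3_z ^ 5}"

definition smooth_or_du_val :: "'p variety \<Rightarrow> bool" where
  "smooth_or_du_val V \<longleftrightarrow>
     (\<forall>p\<in>topspace (vtop V). \<exists>E\<in>du_val_equations. completion_is_hypersurface V p E)"

subsection \<open>Pluricanonical forms and numerical invariants of surfaces\<close>

text \<open>
  \<open>dc = \<mu> da + \<nu> db\<close> at the point \<open>q\<close>, i.e. in \<open>\<mm>\<^sub>q/\<mm>\<^sub>q\<^sup>2\<close>.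
\<close>

definition differential_at ::
  "'p variety \<Rightarrow> 'p \<Rightarrow> ('p \<Rightarrow> complex) \<Rightarrow> ('p \<Rightarrow> complex) \<Rightarrow> ('p \<Rightarrow> complex) \<Rightarrow>
     complex \<Rightarrow> complex \<Rightarrow> bool" where
  "differential_at V q a b c \<mu> \<nu> \<longleftrightarrow>
     (\<lambda>r. (c r - c q) - \<mu> * (a r - a q) - \<nu> * (b r - b q)) \<in> max_ideal_power V q 2"

text \<open>
  \<open>da, db\<close> form a basis of \<open>\<mm>\<^sub>q/\<mm>\<^sub>q\<^sup>2\<close>. On a surface such \<open>a, b\<close> exist if and only if \<open>q\<close> is a
  smooth point.
\<close>

definition local_parameters ::
  "'p variety \<Rightarrow> 'p \<Rightarrow> ('p \<Rightarrow> complex) \<Rightarrow> ('p \<Rightarrow> complex) \<Rightarrow> bool" where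
  "local_parameters V q a b \<longleftrightarrow>
     a \<in> local_functions V q \<and> b \<in> local_functions V q \<and>
     (\<forall>c\<in>local_functions V q. \<exists>!k. differential_at V q a b c (fst k) (snd k))"

text \<open>
  The space \<open>H\<^sup>0(V, nK\<^sub>V)\<close> for a normal surface \<open>V\<close>: the regular sections of the \<open>n\<close>-th power of the
  canonical bundle of the smooth locus. A section is recorded by its coefficients \<open>s (q, a, b)\<close>
  with respect to \<open>(da \<and> db)\<^sup>n\<close>, for all local parameters \<open>a, b\<close> at all smooth points \<open>q\<close>.
\<close>

definition pluricanonical_forms ::
  "'p variety \<Rightarrow> nat \<Rightarrow> ('p \<times> ('p \<Rightarrow> complex) \<times> ('p \<Rightarrow> complex) \<Rightarrow> complex) set" where
  "pluricanonical_forms V n =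
     {s. (\<forall>q a b. \<not> local_parameters V q a b \<longrightarrow> s (q, a, b) = 0) \<and>
         (\<forall>q a b c d \<mu> \<nu> \<mu>' \<nu>'.
            local_parameters V q a b \<and> local_parameters V q c d \<and>
            differential_at V q a b c \<mu> \<nu> \<and> differential_at V q a b d \<mu>' \<nu>' \<longrightarrow>
            s (q, a, b) = (\<mu> * \<nu>' - \<nu> * \<mu>') ^ n * s (q, c, d)) \<and>
         (\<forall>U a b. openin (vtop V) U \<and> (\<forall>q\<in>U. local_parameters V q a b) \<longrightarrow>
            (\<lambda>q. s (q, a, b)) \<in> vreg V U)}"

definition has_complex_dim :: "('z \<Rightarrow> complex) set \<Rightarrow> nat \<Rightarrow> bool" where
  "has_complex_dim S n \<longleftrightarrow>
     (\<exists>b :: nat \<Rightarrow> 'z \<Rightarrow> complex.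
        S = {\<lambda>z. \<Sum>i<n. c i * b i z | c. True} \<and>
        (\<forall>c. (\<forall>z. (\<Sum>i<n. c i * b i z) = 0) \<longrightarrow> (\<forall>i<n. c i = 0)))"

text \<open>
  The open set where a pluricanonical form generates the canonical sheaf. At a Du Val point the
  canonical sheaf is invertible and the surface is normal, so a form generates it there if and
  only if it does not vanish at the smooth points of some neighbourhood.
\<close>

definition nonvanishing_locus ::
  "'p variety \<Rightarrow> ('p \<times> ('p \<Rightarrow> complex) \<times> ('p \<Rightarrow> complex) \<Rightarrow> complex) \<Rightarrow> 'p set" where
  "nonvanishing_locus V s =
     \<Union>{U. openin (vtop V) U \<and> (\<forall>q\<in>U. \<forall>a b. local_parameters V q a b \<longrightarrow> s (q, a, b) \<noteq> 0)}"

text \<open>Ampleness in the sense of EGA II 4.5: these open sets form a base of the topology.\<close>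

definition canonical_class_ample :: "'p variety \<Rightarrow> bool" where
  "canonical_class_ample V \<longleftrightarrow>
     (\<forall>U p. openin (vtop V) U \<and> p \<in> U \<longrightarrow>
        (\<exists>n>0. \<exists>s\<in>pluricanonical_forms V n.
           p \<in> nonvanishing_locus V s \<and> nonvanishing_locus V s \<subseteq> U))"

text \<open>
  A canonical model of a surface of general type is an irreducible projective surface with at
  most Du Val singularities and ample canonical class. Projectivity is not part of the following
  predicate, which is only used for closed subvarieties of Proj of a finitely generated algebra.
  The completions force dimension two and normality.
\<close>

definition canonical_model_general_type :: "'p variety \<Rightarrow> bool" where
  "canonical_model_general_type V \<longleftrightarrow>
     irreducible_variety V \<and> smooth_or_du_val V \<and> canonical_class_ample V"

text \<open>\<open>p\<^sub>g = h\<^sup>0(K)\<close>; Du Val singularities do not affect it, nor \<open>q = h\<^sup>1(\<O>)\<close> or \<open>K\<^sup>2\<close>.\<close>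

definition has_geometric_genus :: "'p variety \<Rightarrow> nat \<Rightarrow> bool" where
  "has_geometric_genus V pg \<longleftrightarrow> has_complex_dim (pluricanonical_forms V 1) pg"

text \<open>
  \<open>q = 0\<close>, i.e. \<open>H\<^sup>1(V, \<O>) = 0\<close>: every Cech 1-cocycle of every finite open cover is a coboundary.
  (In degree one the Cech group of a cover embeds into \<open>H\<^sup>1\<close>, and \<open>H\<^sup>1\<close> is the union of these.)
\<close>

definition irregularity_zero :: "'p variety \<Rightarrow> bool" where
  "irregularity_zero V \<longleftrightarrow>
     (\<forall>(m::nat) U f.
        (\<forall>i<m. openin (vtop V) (U i)) \<and> (\<Union>i<m. U i) = topspace (vtop V) \<and>
        (\<forall>i<m. \<forall>j<m. f i j \<in> vreg V (U i \<inter> U j)) \<and>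
        (\<forall>i<m. \<forall>j<m. \<forall>k<m. \<forall>P\<in>U i \<inter> U j \<inter> U k. f i j P + f j k P = f i k P) \<longrightarrow>
        (\<exists>g. (\<forall>i<m. g i \<in> vreg V (U i)) \<and>
             (\<forall>i<m. \<forall>j<m. \<forall>P\<in>U i \<inter> U j. f i j P = g i P - g j P)))"

text \<open>
  The self-intersection of the ample class \<open>K\<close> as the degree of its section ring:
  \<open>h\<^sup>0(nK) = K\<^sup>2 n\<^sup>2/2 + O(n)\<close>.
\<close>

definition has_canonical_degree :: "'p variety \<Rightarrow> real \<Rightarrow> bool" where
  "has_canonical_degree V k \<longleftrightarrow>
     (\<exists>P :: nat \<Rightarrow> nat. (\<forall>n. has_complex_dim (pluricanonical_forms V n) (P n)) \<and>
        (\<lambda>n. 2 * real (P n) / real n ^ 2) \<longlonglongrightarrow> k)"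

section \<open>Fraction fields and Proj\<close>

definition frac_class :: "'a ring \<Rightarrow> 'a \<Rightarrow> 'a \<Rightarrow> ('a \<times> 'a) set" where
  "frac_class A a b =
     {(c, d). c \<in> carrier A \<and> d \<in> carrier A - {\<zero>\<^bsub>A\<^esub>} \<and> a \<otimes>\<^bsub>A\<^esub> d = c \<otimes>\<^bsub>A\<^esub> b}"

definition frac_field :: "'a ring \<Rightarrow> ('a \<times> 'a) set ring" where
  "frac_field A =
     \<lparr>carrier = {frac_class A a b | a b. a \<in> carrier A \<and> b \<in> carrier A - {\<zero>\<^bsub>A\<^esub>}},
      monoid.mult = (\<lambda>p q. \<Union>((\<lambda>((a, b), (c, d)).
                frac_class A (a \<otimes>\<^bsub>A\<^esub> c) (b \<otimes>\<^bsub>A\<^esub> d)) ` (p \<times> q))),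
      one = frac_class A \<one>\<^bsub>A\<^esub> \<one>\<^bsub>A\<^esub>,
      zero = frac_class A \<zero>\<^bsub>A\<^esub> \<one>\<^bsub>A\<^esub>,
      add = (\<lambda>p q. \<Union>((\<lambda>((a, b), (c, d)).
               frac_class A ((a \<otimes>\<^bsub>A\<^esub> d) \<oplus>\<^bsub>A\<^esub> (c \<otimes>\<^bsub>A\<^esub> b)) (b \<otimes>\<^bsub>A\<^esub> d)) ` (p \<times> q)))\<rparr>"

text \<open>
  Closed points of Proj of a finitely generated graded \<open>\<complex>\<close>-algebra \<open>S\<close>, with structure map \<open>\<iota>\<close>
  and homogeneous parts \<open>D n\<close>. A point is a \<open>\<complex>\<^sup>*\<close>-orbit of algebra homomorphisms \<open>S \<rightarrow> \<complex>\<close> that do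
  not kill all elements of positive degree; evaluating at homogeneous generators of \<open>S\<close> gives the
  usual homogeneous coordinates of a point of weighted projective space.
\<close>

definition proj_coords ::
  "'a ring \<Rightarrow> (complex \<Rightarrow> 'a) \<Rightarrow> (nat \<Rightarrow> 'a set) \<Rightarrow> ('a \<Rightarrow> complex) set" where
  "proj_coords S \<iota> D =
     {\<chi> \<in> ring_hom S ring_of_type_algebra \<inter> extensional (carrier S).
        (\<forall>c. \<chi> (\<iota> c) = c) \<and> (\<exists>n>0. \<exists>s\<in>D n. \<chi> s \<noteq> 0)}"

definition proj_points ::
  "'a ring \<Rightarrow> (complex \<Rightarrow> 'a) \<Rightarrow> (nat \<Rightarrow> 'a set) \<Rightarrow> ('a \<Rightarrow> complex) set set" where
  "proj_points S \<iota> D =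
     {{\<chi>' \<in> proj_coords S \<iota> D. \<exists>c. c \<noteq> 0 \<and> (\<forall>n. \<forall>s\<in>D n. \<chi>' s = c ^ n * \<chi> s)}
        | \<chi>. \<chi> \<in> proj_coords S \<iota> D}"

definition Proj ::
  "'a ring \<Rightarrow> (complex \<Rightarrow> 'a) \<Rightarrow> (nat \<Rightarrow> 'a set) \<Rightarrow> ('a \<Rightarrow> complex) set variety" where
  "Proj S \<iota> D =
     (let T = topology_generated_by
                {{P \<in> proj_points S \<iota> D. \<forall>\<chi>\<in>P. \<chi> s \<noteq> 0} | s. s \<in> (\<Union>n. D n)}
      in \<lparr>vtop = T,
          vreg = (\<lambda>U. {f. \<forall>P\<in>U. \<exists>V n. \<exists>a\<in>D n. \<exists>b\<in>D n. openin T V \<and> P \<in> V \<and> V \<subseteq> U \<and>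
                             (\<forall>Q\<in>V. \<forall>\<chi>\<in>Q. \<chi> b \<noteq> 0 \<and> f Q = \<chi> a / \<chi> b)})\<rparr>)"

section \<open>Polynomial rings\<close>

type_synonym 'v mpoly = "('v \<Rightarrow>\<^sub>0 nat) \<Rightarrow>\<^sub>0 complex"

definition mconst :: "complex \<Rightarrow> 'v mpoly" where
  "mconst c = Poly_Mapping.single 0 c"

definition mvar :: "'v \<Rightarrow> 'v mpoly" where
  "mvar v = Poly_Mapping.single (Poly_Mapping.single v 1) 1"

definition msubst :: "('v \<Rightarrow> 'w mpoly) \<Rightarrow> 'v mpoly \<Rightarrow> 'w mpoly" where
  "msubst g p = (\<Sum>m\<in>Poly_Mapping.keys p. mconst (Poly_Mapping.lookup p m) *
                   (\<Prod>v\<in>Poly_Mapping.keys m. g v ^ Poly_Mapping.lookup m v))"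

definition homogeneous :: "('v \<Rightarrow> nat) \<Rightarrow> nat \<Rightarrow> 'v mpoly \<Rightarrow> bool" where
  "homogeneous wt d p \<longleftrightarrow>
     (\<forall>m\<in>Poly_Mapping.keys p. (\<Sum>v\<in>Poly_Mapping.keys m. wt v * Poly_Mapping.lookup m v) = d)"

text \<open>The variables of \<open>R\<close> and of the coordinate ring \<open>\<complex>[x,u,v]\<close> of the plane.\<close>

datatype rvar = Rx | Ry1 | Ry2 | Ry3 | Rz1 | Rz2
datatype pvar = Px | Pu | Pv

fun rweight :: "rvar \<Rightarrow> nat" where
  "rweight Rx = 1" | "rweight Ry1 = 2" | "rweight Ry2 = 2" | "rweight Ry3 = 2"
| "rweight Rz1 = 3" | "rweight Rz2 = 3"

abbreviation pweight :: "pvar \<Rightarrow> nat" where "pweight \<equiv> (\<lambda>_. 1)"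

abbreviation ring_R :: "rvar mpoly ring" where "ring_R \<equiv> ring_of_type_algebra"

section \<open>The plane and its image\<close>

definition poly_f :: "complex \<Rightarrow> rvar mpoly" where
  "poly_f \<alpha> = mvar Ry1 + mconst \<alpha> * mvar Ry3"

definition poly_g :: "complex \<Rightarrow> rvar mpoly" where
  "poly_g \<alpha> = mconst \<alpha> * mvar Ry1 + mvar Ry3"

fun phi_y :: "complex \<Rightarrow> rvar \<Rightarrow> pvar mpoly" where
  "phi_y l Rx = mvar Px"
| "phi_y l Ry1 = mvar Pu ^ 2 + mconst 2 * mvar Px * mvar Pv"
| "phi_y l Ry2 = mconst l * mvar Px * (mvar Pu - mvar Pv)"
| "phi_y l Ry3 = mvar Pv ^ 2 + mconst 2 * mvar Px * mvar Pu"
| "phi_y l _ = 0"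

text \<open>The values of \<open>\<Phi>\<^sup>*\<close> at the variables; \<open>phi_y\<close> is enough to evaluate \<open>f\<close> and \<open>g\<close>.\<close>

fun phi_var :: "complex \<Rightarrow> complex \<Rightarrow> rvar \<Rightarrow> pvar mpoly" where
  "phi_var \<alpha> l Rz1 =
     mvar Pu * (msubst (phi_y l) (poly_f \<alpha>) + mconst (\<alpha> * (1 + \<alpha>)) * mvar Px ^ 2)
     + mconst (1 - \<alpha>\<^sup>2) * mvar Px * mvar Pu * mvar Pv
     - mconst (\<alpha> * (1 - \<alpha>\<^sup>2)) * mvar Px ^ 2 * mvar Pv"
| "phi_var \<alpha> l Rz2 =
     mvar Pv * (msubst (phi_y l) (poly_g \<alpha>) + mconst (\<alpha> * (1 + \<alpha>)) * mvar Px ^ 2)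
     + mconst (1 - \<alpha>\<^sup>2) * mvar Px * mvar Pu * mvar Pv
     - mconst (\<alpha> * (1 - \<alpha>\<^sup>2)) * mvar Px ^ 2 * mvar Pu"
| "phi_var \<alpha> l w = phi_y l w"

definition phi :: "complex \<Rightarrow> complex \<Rightarrow> rvar mpoly \<Rightarrow> pvar mpoly" where
  "phi \<alpha> l = msubst (phi_var \<alpha> l)"

definition gamma_ideal :: "complex \<Rightarrow> complex \<Rightarrow> rvar mpoly set" where
  "gamma_ideal \<alpha> l = {p. phi \<alpha> l p = 0}"

definition gamma_ideal6 :: "complex \<Rightarrow> complex \<Rightarrow> rvar mpoly set" where
  "gamma_ideal6 \<alpha> l = {p \<in> gamma_ideal \<alpha> l. homogeneous rweight 6 p}"

text \<open>The residues modulo \<open>x\<close> of \<open>C\<^sub>1, C\<^sub>2, Q\<^sub>1, Q\<^sub>2, Q\<^sub>3, Q\<^sub>4\<close>, in this order.\<close>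

definition residues6 :: "complex \<Rightarrow> rvar mpoly list" where
  "residues6 \<alpha> =
     [mvar Rz1 ^ 2 - mvar Ry1 * poly_f \<alpha> ^ 2, mvar Rz2 ^ 2 - mvar Ry3 * poly_g \<alpha> ^ 2,
      poly_f \<alpha> * mvar Ry2 ^ 2, mvar Ry2 ^ 3, poly_g \<alpha> * mvar Ry2 ^ 2,
      poly_f \<alpha> * poly_g \<alpha> * mvar Ry2]"

definition is_generator6 :: "complex \<Rightarrow> complex \<Rightarrow> nat \<Rightarrow> rvar mpoly \<Rightarrow> bool" where
  "is_generator6 \<alpha> l i p \<longleftrightarrow> p \<in> gamma_ideal6 \<alpha> l \<and> mvar Rx dvd p - residues6 \<alpha> ! i"

definition generator6 :: "complex \<Rightarrow> complex \<Rightarrow> nat \<Rightarrow> rvar mpoly" where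
  "generator6 \<alpha> l i = (THE p. is_generator6 \<alpha> l i p)"

text \<open>
  The six polynomials exist and span. They are then unique exactly when \<open>I\<^sub>\<Gamma>\<close> is zero in degree 5,
  which is what makes \<open>C\<^sub>i\<close>, \<open>Q\<^sub>i\<close> well defined; all this holds for general \<open>\<alpha>\<close>.
\<close>

definition generators6_exist :: "complex \<Rightarrow> complex \<Rightarrow> bool" where
  "generators6_exist \<alpha> l \<longleftrightarrow>
     (\<forall>i<6. \<exists>!p. is_generator6 \<alpha> l i p) \<and>
     gamma_ideal6 \<alpha> l = {\<Sum>i<6. mconst (c i) * generator6 \<alpha> l i | c. True}"

definition poly_F :: "complex \<Rightarrow> complex \<Rightarrow> complex \<Rightarrow> complex \<Rightarrow> complex \<Rightarrow> complex \<Rightarrow> rvar mpoly" where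
  "poly_F \<alpha> l l1 l2 l3 l4 =
     generator6 \<alpha> l 0 + mconst l1 * generator6 \<alpha> l 2 + mconst l2 * generator6 \<alpha> l 3
       + mconst l3 * generator6 \<alpha> l 4 + mconst l4 * generator6 \<alpha> l 5"

definition poly_G :: "complex \<Rightarrow> complex \<Rightarrow> complex \<Rightarrow> complex \<Rightarrow> complex \<Rightarrow> complex \<Rightarrow> rvar mpoly" where
  "poly_G \<alpha> l l1 l2 l3 l4 =
     generator6 \<alpha> l 1 + mconst l3 * generator6 \<alpha> l 2 - mconst l2 * generator6 \<alpha> l 3
       + mconst l1 * generator6 \<alpha> l 4 - mconst l4 * generator6 \<alpha> l 5"

definition ideal_FG ::
  "complex \<Rightarrow> complex \<Rightarrow> complex \<Rightarrow> complex \<Rightarrow> complex \<Rightarrow> complex \<Rightarrow> rvar mpoly set" where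
  "ideal_FG \<alpha> l l1 l2 l3 l4 = Idl\<^bsub>ring_R\<^esub> {poly_F \<alpha> l l1 l2 l3 l4, poly_G \<alpha> l l1 l2 l3 l4}"

section \<open>The unprojection\<close>

text \<open>Below, \<open>J\<close> stands for the homogeneous prime ideal \<open>(F, G)\<close> of \<open>R\<close>, and \<open>A = R/J\<close>.\<close>

type_synonym frac_elt = "(rvar mpoly set \<times> rvar mpoly set) set"

definition ring_A :: "rvar mpoly set \<Rightarrow> rvar mpoly set ring" where
  "ring_A J = ring_R Quot J"

definition field_K :: "rvar mpoly set \<Rightarrow> frac_elt ring" where
  "field_K J = frac_field (ring_A J)"

definition to_K :: "rvar mpoly set \<Rightarrow> rvar mpoly \<Rightarrow> frac_elt" where
  "to_K J p = frac_class (ring_A J) (J +>\<^bsub>ring_R\<^esub> p) \<one>\<^bsub>ring_A J\<^esub>"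

text \<open>The quotients of homogeneous elements of \<open>A\<close> that have degree \<open>d\<close>.\<close>

definition K_degree :: "rvar mpoly set \<Rightarrow> nat \<Rightarrow> frac_elt set" where
  "K_degree J d =
     {q \<in> carrier (field_K J). \<exists>m a b. homogeneous rweight (m + d) a \<and> homogeneous rweight m b \<and>
        to_K J b \<noteq> \<zero>\<^bsub>field_K J\<^esub> \<and> q \<otimes>\<^bsub>field_K J\<^esub> to_K J b = to_K J a}"

text \<open>\<open>Hom\<^sub>A(I, A)\<close>, with a homomorphism regarded as multiplication by an element of \<open>K\<close>.\<close>

definition hom_I_A :: "complex \<Rightarrow> complex \<Rightarrow> rvar mpoly set \<Rightarrow> frac_elt set" where
  "hom_I_A \<alpha> l J =
     {q \<in> carrier (field_K J). \<forall>p\<in>gamma_ideal \<alpha> l. q \<otimes>\<^bsub>field_K J\<^esub> to_K J p \<in> range (to_K J)}"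

text \<open>
  The exact sequence \<open>0 \<rightarrow> \<omega>\<^sub>A \<rightarrow> Hom\<^sub>A(I, \<omega>\<^sub>A) \<rightarrow> \<omega>\<^sub>\<Gamma> \<rightarrow> 0\<close> of graded modules. By \<open>\<omega>\<^sub>A \<cong> A(-1)\<close> and
  \<open>\<omega>\<^sub>\<Gamma> \<cong> \<complex>[x,u,v](-3)\<close> it becomes \<open>0 \<rightarrow> A \<rightarrow> Hom\<^sub>A(I, A) \<rightarrow> \<complex>[x,u,v](-2) \<rightarrow> 0\<close>. The map \<open>\<rho>\<close> is
  determined up to a nonzero constant by these properties, as \<open>\<complex>[x,u,v](-3)\<close> has no other graded
  automorphisms over \<open>R\<close>.
\<close>

definition residue_map ::
  "complex \<Rightarrow> complex \<Rightarrow> rvar mpoly set \<Rightarrow> (frac_elt \<Rightarrow> pvar mpoly) \<Rightarrow> bool" where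
  "residue_map \<alpha> l J \<rho> \<longleftrightarrow>
     (\<forall>q\<in>hom_I_A \<alpha> l J. \<forall>q'\<in>hom_I_A \<alpha> l J. \<rho> (q \<oplus>\<^bsub>field_K J\<^esub> q') = \<rho> q + \<rho> q') \<and>
     (\<forall>p. \<forall>q\<in>hom_I_A \<alpha> l J. \<rho> (to_K J p \<otimes>\<^bsub>field_K J\<^esub> q) = phi \<alpha> l p * \<rho> q) \<and>
     {q \<in> hom_I_A \<alpha> l J. \<rho> q = 0} = range (to_K J) \<and>
     \<rho> ` hom_I_A \<alpha> l J = UNIV \<and>
     (\<forall>d. \<forall>q\<in>hom_I_A \<alpha> l J \<inter> K_degree J d.
        if d < 2 then \<rho> q = 0 else homogeneous pweight (d - 2) (\<rho> q))"

text \<open>Lifts \<open>y\<^sub>4, z\<^sub>3, z\<^sub>4, t\<close> of \<open>1, u, v, uv\<close>.\<close>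

definition unprojection_lifts ::
  "complex \<Rightarrow> complex \<Rightarrow> rvar mpoly set \<Rightarrow> frac_elt \<times> frac_elt \<times> frac_elt \<times> frac_elt \<Rightarrow> bool" where
  "unprojection_lifts \<alpha> l J = (\<lambda>(y4, z3, z4, t).
     \<exists>\<rho>. residue_map \<alpha> l J \<rho> \<and>
       y4 \<in> hom_I_A \<alpha> l J \<inter> K_degree J 2 \<and> \<rho> y4 = 1 \<and>
       z3 \<in> hom_I_A \<alpha> l J \<inter> K_degree J 3 \<and> \<rho> z3 = mvar Pu \<and>
       z4 \<in> hom_I_A \<alpha> l J \<inter> K_degree J 3 \<and> \<rho> z4 = mvar Pv \<and>
       t \<in> hom_I_A \<alpha> l J \<inter> K_degree J 4 \<and> \<rho> t = mvar Pu * mvar Pv)"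

text \<open>The ring \<open>A[y\<^sub>4, z\<^sub>3, z\<^sub>4, t]\<close>; it does not depend on the choice of the lifts.\<close>

definition unprojection_ring :: "complex \<Rightarrow> complex \<Rightarrow> rvar mpoly set \<Rightarrow> frac_elt ring" where
  "unprojection_ring \<alpha> l J =
     (case SOME ys. unprojection_lifts \<alpha> l J ys of (y4, z3, z4, t) \<Rightarrow>
        field_K J \<lparr>carrier := generate_ring (field_K J) (range (to_K J) \<union> {y4, z3, z4, t})\<rparr>)"

definition unprojection_degree ::
  "complex \<Rightarrow> complex \<Rightarrow> rvar mpoly set \<Rightarrow> nat \<Rightarrow> frac_elt set" where
  "unprojection_degree \<alpha> l J d = carrier (unprojection_ring \<alpha> l J) \<inter> K_degree J d"

definition variety_W :: "complex \<Rightarrow> complex \<Rightarrow> rvar mpoly set \<Rightarrow> (frac_elt \<Rightarrow> complex) set variety" where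
  "variety_W \<alpha> l J =
     Proj (unprojection_ring \<alpha> l J) (\<lambda>c. to_K J (mconst c)) (unprojection_degree \<alpha> l J)"

section \<open>The involution\<close>

fun sigma_var :: "rvar \<Rightarrow> rvar mpoly" where
  "sigma_var Rx = - mvar Rx"
| "sigma_var Ry1 = mvar Ry3" | "sigma_var Ry2 = - mvar Ry2" | "sigma_var Ry3 = mvar Ry1"
| "sigma_var Rz1 = - mvar Rz2" | "sigma_var Rz2 = - mvar Rz1"

definition sigma_R :: "rvar mpoly \<Rightarrow> rvar mpoly" where
  "sigma_R = msubst sigma_var"

text \<open>
  The induced automorphism of \<open>K\<close>. It exchanges \<open>F\<close> and \<open>G\<close>, so it permutes the cosets of
  \<open>(F, G)\<close>, and an element of \<open>K\<close> is a class of pairs of cosets.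
\<close>

definition sigma_K :: "frac_elt \<Rightarrow> frac_elt" where
  "sigma_K q = (\<lambda>(a, b). (sigma_R ` a, sigma_R ` b)) ` q"

definition sigma_W ::
  "complex \<Rightarrow> complex \<Rightarrow> rvar mpoly set \<Rightarrow> (frac_elt \<Rightarrow> complex) set \<Rightarrow> (frac_elt \<Rightarrow> complex) set" where
  "sigma_W \<alpha> l J P =
     (\<lambda>\<chi>. restrict (\<lambda>s. \<chi> (sigma_K s)) (carrier (unprojection_ring \<alpha> l J))) ` P"

text \<open>\<open>H\<^sup>0(W, -2K\<^sub>W)\<^sup>-\<close>\<close>

definition anti_invariants2 :: "complex \<Rightarrow> complex \<Rightarrow> rvar mpoly set \<Rightarrow> frac_elt set" where
  "anti_invariants2 \<alpha> l J =
     {h \<in> unprojection_degree \<alpha> l J 2. sigma_K h = \<ominus>\<^bsub>field_K J\<^esub> h}"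

definition anti_invariants2_dim3 :: "complex \<Rightarrow> complex \<Rightarrow> rvar mpoly set \<Rightarrow> bool" where
  "anti_invariants2_dim3 \<alpha> l J \<longleftrightarrow>
     (\<exists>h1 h2 h3. h1 \<in> carrier (field_K J) \<and> h2 \<in> carrier (field_K J) \<and> h3 \<in> carrier (field_K J) \<and>
        (let comb = (\<lambda>a b c. to_K J (mconst a) \<otimes>\<^bsub>field_K J\<^esub> h1 \<oplus>\<^bsub>field_K J\<^esub>
               (to_K J (mconst b) \<otimes>\<^bsub>field_K J\<^esub> h2 \<oplus>\<^bsub>field_K J\<^esub> to_K J (mconst c) \<otimes>\<^bsub>field_K J\<^esub> h3))
         in anti_invariants2 \<alpha> l J = {comb a b c | a b c. True} \<and>
            (\<forall>a b c. comb a b c = \<zero>\<^bsub>field_K J\<^esub> \<longrightarrow> a = 0 \<and> b = 0 \<and> c = 0)))"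

text \<open>
  The projective plane of the points \<open>[h]\<close>, with \<open>h\<close> nonzero in \<open>H\<^sup>0(W, -2K\<^sub>W)\<^sup>-\<close>; a point is the set of
  nonzero multiples of \<open>h\<close>.
\<close>

definition plane_of_anti_invariants ::
  "complex \<Rightarrow> complex \<Rightarrow> rvar mpoly set \<Rightarrow> frac_elt set set" where
  "plane_of_anti_invariants \<alpha> l J =
     {{to_K J (mconst c) \<otimes>\<^bsub>field_K J\<^esub> h | c. c \<noteq> 0} | h.
        h \<in> anti_invariants2 \<alpha> l J \<and> h \<noteq> \<zero>\<^bsub>field_K J\<^esub>}"

section \<open>Coughlan's family\<close>

text \<open>\<open>Y = {h = 0} \<subset> W\<close>, for the point \<open>H = [h]\<close> of the plane.\<close>

definition coughlan_Y ::
  "complex \<Rightarrow> complex \<Rightarrow> complex \<Rightarrow> complex \<Rightarrow> complex \<Rightarrow> complex \<Rightarrow> frac_elt set \<Rightarrow>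
     (frac_elt \<Rightarrow> complex) set variety" where
  "coughlan_Y \<alpha> l l1 l2 l3 l4 H =
     (let W = variety_W \<alpha> l (ideal_FG \<alpha> l l1 l2 l3 l4)
      in closed_subvariety W {P \<in> topspace (vtop W). \<forall>\<chi>\<in>P. \<forall>h\<in>H. \<chi> h = 0})"

definition coughlan_X ::
  "complex \<Rightarrow> complex \<Rightarrow> complex \<Rightarrow> complex \<Rightarrow> complex \<Rightarrow> complex \<Rightarrow> frac_elt set \<Rightarrow>
     (frac_elt \<Rightarrow> complex) set set variety" where
  "coughlan_X \<alpha> l l1 l2 l3 l4 H =
     quotient_variety (coughlan_Y \<alpha> l l1 l2 l3 l4 H) (sigma_W \<alpha> l (ideal_FG \<alpha> l l1 l2 l3 l4))"

text \<open>The objects of the construction of \<open>W\<close> exist for these parameters.\<close>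

definition coughlan_general ::
  "complex \<Rightarrow> complex \<Rightarrow> complex \<Rightarrow> complex \<Rightarrow> complex \<Rightarrow> complex \<Rightarrow> bool" where
  "coughlan_general \<alpha> l l1 l2 l3 l4 \<longleftrightarrow>
     l \<noteq> 0 \<and> generators6_exist \<alpha> l \<and>
     (let J = ideal_FG \<alpha> l l1 l2 l3 l4
      in primeideal J ring_R \<and> (\<exists>ys. unprojection_lifts \<alpha> l J ys) \<and> anti_invariants2_dim3 \<alpha> l J)"

text \<open>
  \<open>Y\<close> is a member of the family. As \<open>R(Y, K\<^sub>Y) = R(W, -K\<^sub>W)/(h)\<close> is the canonical ring of a surface,
  \<open>(h)\<close> is prime; in particular the scheme \<open>{h = 0}\<close> is reduced, so nothing is lost by regarding \<open>Y\<close>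
  as a variety.
\<close>

definition coughlan_member ::
  "complex \<Rightarrow> complex \<Rightarrow> complex \<Rightarrow> complex \<Rightarrow> complex \<Rightarrow> complex \<Rightarrow> frac_elt set \<Rightarrow> bool" where
  "coughlan_member \<alpha> l l1 l2 l3 l4 H \<longleftrightarrow>
     coughlan_general \<alpha> l l1 l2 l3 l4 \<and>
     (let J = ideal_FG \<alpha> l l1 l2 l3 l4; S = unprojection_ring \<alpha> l J;
          Y = coughlan_Y \<alpha> l l1 l2 l3 l4 H
      in H \<in> plane_of_anti_invariants \<alpha> l J \<and> primeideal (Idl\<^bsub>S\<^esub> H) S \<and>
         canonical_model_general_type Y \<and>
         has_geometric_genus Y 1 \<and> irregularity_zero Y \<and> has_canonical_degree Y 2 \<and>
         (\<forall>P\<in>topspace (vtop Y). sigma_W \<alpha> l J P \<noteq> P))"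

end

theory Submission
  imports Defs
begin

text \<open>
  The parameter \<open>l\<close> enters the construction only through \<open>\<Phi>\<^sup>*(y\<^sub>2) = l x (u - v)\<close>, so the rescaling
  \<open>y\<^sub>2 \<mapsto> l y\<^sub>2\<close> of \<open>R\<close> turns \<open>\<Phi>\<^sup>*\<close> for \<open>l\<close> into \<open>\<Phi>\<^sup>*\<close> for \<open>1\<close>. It multiplies \<open>C\<^sub>1, C\<^sub>2, Q\<^sub>1, Q\<^sub>2, Q\<^sub>3, Q\<^sub>4\<close> by
  \<open>1, 1, l\<^sup>2, l\<^sup>3, l\<^sup>2, l\<close>, hence carries \<open>(F, G)\<close> to the ideal with parameters
  \<open>(l\<^sup>2 l\<^sub>1, l\<^sup>3 l\<^sub>2, l\<^sup>2 l\<^sub>3, l l\<^sub>4)\<close>, and it commutes with \<open>\<sigma>\<close>. Everything else in the construction is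
  natural, i.e. relationally parametric, so it is transported along this bijection. The exception is the
  choice of \<open>y\<^sub>4, z\<^sub>3, z\<^sub>4, t\<close>: the ring they generate is independent of it because \<open>u\<close> and \<open>v\<close> lie in the
  fraction field of the image of \<open>\<Phi>\<^sup>*\<close>, which makes the residue map unique up to a constant.
\<close>

section \<open>Parametricity of varieties and their invariants\<close>

text \<open>When \<open>P\<close> is the graph of a bijection, this says that the bijection is a
  homeomorphism. The relator form makes \<open>openin\<close> parametric by definition.\<close>

definition rel_topology :: "('a \<Rightarrow> 'b \<Rightarrow> bool) \<Rightarrow> 'a topology \<Rightarrow> 'b topology \<Rightarrow> bool" where
  "rel_topology P T T' \<longleftrightarrow> rel_fun (rel_set P) (=) (openin T) (openin T')"

text \<open>For a bijection this is an isomorphism whose condition on regular functions is imposed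
  on every subset, not only on open ones. The stronger form lets \<open>vreg\<close> be transported
  without a side condition on its argument.\<close>

definition rel_variety :: "('a \<Rightarrow> 'b \<Rightarrow> bool) \<Rightarrow> 'a variety \<Rightarrow> 'b variety \<Rightarrow> bool" where
  "rel_variety P V V' \<longleftrightarrow> rel_topology P (vtop V) (vtop V') \<and>
     rel_fun (rel_set P) (rel_set (rel_fun P (=))) (vreg V) (vreg V')"

text \<open>
  The constants \<open>generated_topology\<close> here and \<open>mk_ring\<close> below stand for an abbreviation and a record
  expression, because \<open>transfer_prover\<close> needs one transfer rule per constant.
\<close>

definition generated_topology :: "'a set set \<Rightarrow> 'a topology" where
  "generated_topology B = topology_generated_by B"

context
  includes lifting_syntax
begin

lemma openin_transfer [transfer_rule]:
  "(rel_topology P ===> rel_set P ===> (=)) openin openin"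
  by (simp add: rel_fun_def rel_topology_def)

lemma vtop_transfer [transfer_rule]: "(rel_variety P ===> rel_topology P) vtop vtop"
  by (simp add: rel_fun_def rel_variety_def)

lemma vreg_transfer [transfer_rule]:
  "(rel_variety P ===> rel_set P ===> rel_set (P ===> (=))) vreg vreg"
  by (simp add: rel_fun_def rel_variety_def)

text \<open>A record literal abbreviates \<open>variety.variety_ext\<close> applied to its fields
  and to the unit extension, so this single rule covers all varieties given by explicit
  fields.\<close>

lemma variety_ext_transfer [transfer_rule]:
  "(rel_topology P ===> (rel_set P ===> rel_set (P ===> (=))) ===> (=) ===> rel_variety P)
     variety.variety_ext variety.variety_ext"
  by (simp add: rel_fun_def rel_variety_def)

lemma topspace_transfer [transfer_rule]:
  assumes [transfer_rule]: "bi_unique P" "bi_total P"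
  shows "(rel_topology P ===> rel_set P) topspace topspace"
  unfolding topspace_def by transfer_prover

text \<open>Topologies are compared by their open sets, and those of a subspace are described by an
  existential over open sets of the ambient space.\<close>

lemma subtopology_transfer [transfer_rule]:
  assumes [transfer_rule]: "bi_unique P" "bi_total P"
  shows "(rel_topology P ===> rel_set P ===> rel_topology P) subtopology subtopology"
proof -
  have "(rel_topology P ===> rel_set P ===> rel_set P ===> (=))
    (\<lambda>U V S. \<exists>T. openin U T \<and> S = T \<inter> V) (\<lambda>U V S. \<exists>T. openin U T \<and> S = T \<inter> V)"
    by transfer_prover
  then show ?thesis
    by (simp add: rel_fun_def rel_topology_def openin_subtopology)
qed

text \<open>The least predicate closed under the generating rules is the intersection of all closed
  ones. This second-order form uses only logic and set operations, so its parametricity is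
  automatic, which is not so for an inductive definition.\<close>

lemma generate_topology_on_eq:
  "generate_topology_on = (\<lambda>B s. \<forall>G. G {} \<and> (\<forall>a b. G a \<longrightarrow> G b \<longrightarrow> G (a \<inter> b)) \<and>
     (\<forall>K. (\<forall>k\<in>K. G k) \<longrightarrow> G (\<Union>K)) \<and> (\<forall>s\<in>B. G s) \<longrightarrow> G s)"
proof (intro ext iffI allI impI)
  fix B :: "'a set set" and s G
  assume "generate_topology_on B s" "G {} \<and> (\<forall>a b. G a \<longrightarrow> G b \<longrightarrow> G (a \<inter> b)) \<and>
    (\<forall>K. (\<forall>k\<in>K. G k) \<longrightarrow> G (\<Union>K)) \<and> (\<forall>s\<in>B. G s)"
  then show "G s" by (induction rule: generate_topology_on.induct) auto
next
  fix B :: "'a set set" and s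
  assume "\<forall>G. G {} \<and> (\<forall>a b. G a \<longrightarrow> G b \<longrightarrow> G (a \<inter> b)) \<and>
    (\<forall>K. (\<forall>k\<in>K. G k) \<longrightarrow> G (\<Union>K)) \<and> (\<forall>s\<in>B. G s) \<longrightarrow> G s"
  from this[rule_format, of "generate_topology_on B"] show "generate_topology_on B s"
    by (blast intro: generate_topology_on.intros)
qed

lemma generate_topology_on_transfer:
  assumes [transfer_rule]: "bi_unique P" "bi_total P"
  shows "(rel_set (rel_set P) ===> rel_set P ===> (=)) generate_topology_on generate_topology_on"
  unfolding generate_topology_on_eq by transfer_prover

lemma generated_topology_transfer [transfer_rule]:
  assumes [transfer_rule]: "bi_unique P" "bi_total P"
  shows "(rel_set (rel_set P) ===> rel_topology P) generated_topology generated_topology"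
  using generate_topology_on_transfer[OF assms]
  by (simp add: rel_fun_def rel_topology_def generated_topology_def openin_topology_generated_by_iff)

section \<open>Closed subvarieties and quotients by an involution\<close>

lemma closed_subvariety_transfer [transfer_rule]:
  assumes [transfer_rule]: "bi_unique P" "bi_total P"
  shows "(rel_variety P ===> rel_set P ===> rel_variety P) closed_subvariety closed_subvariety"
  unfolding closed_subvariety_def by transfer_prover

text \<open>The constructor \<open>topology\<close> can be inverted only on predicates satisfying
  \<open>istopology\<close>. That condition holds here because preimages under the orbit map commute
  with intersections and unions.\<close>

lemma openin_quotient_variety:
  "openin (vtop (quotient_variety V s)) U \<longleftrightarrow> U \<subseteq> (\<lambda>P. {P, s P}) ` topspace (vtop V) \<and>
     openin (vtop V) {P \<in> topspace (vtop V). {P, s P} \<in> U}"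
proof -
  let ?Q = "\<lambda>U. {P \<in> topspace (vtop V). {P, s P} \<in> U}"
  have "istopology (\<lambda>U. U \<subseteq> (\<lambda>P. {P, s P}) ` topspace (vtop V) \<and> openin (vtop V) (?Q U))"
    unfolding istopology_def
  proof (intro conjI allI impI)
    fix S T
    assume "S \<subseteq> (\<lambda>P. {P, s P}) ` topspace (vtop V) \<and> openin (vtop V) (?Q S)"
      "T \<subseteq> (\<lambda>P. {P, s P}) ` topspace (vtop V) \<and> openin (vtop V) (?Q T)"
    moreover have "?Q (S \<inter> T) = ?Q S \<inter> ?Q T" by auto
    ultimately show "S \<inter> T \<subseteq> (\<lambda>P. {P, s P}) ` topspace (vtop V)" "openin (vtop V) (?Q (S \<inter> T))"
      by auto
  next
    fix K
    assume K: "\<forall>U\<in>K. U \<subseteq> (\<lambda>P. {P, s P}) ` topspace (vtop V) \<and> openin (vtop V) (?Q U)"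
    then show "\<Union>K \<subseteq> (\<lambda>P. {P, s P}) ` topspace (vtop V)" by auto
    have "?Q (\<Union>K) = \<Union>(?Q ` K)" by auto
    with K show "openin (vtop V) (?Q (\<Union>K))" by auto
  qed
  then show ?thesis by (simp add: quotient_variety_def topology_inverse')
qed

text \<open>The points of the quotient are orbits, that is, sets of points, which is why the
  relation becomes \<open>rel_set P\<close>. The open sets are treated separately, through
  \<open>openin_quotient_variety\<close>, in order to bypass the constructor
  \<open>topology\<close>.\<close>

lemma quotient_variety_transfer [transfer_rule]:
  assumes [transfer_rule]: "bi_unique P" "bi_total P"
  shows "(rel_variety P ===> (P ===> P) ===> rel_variety (rel_set P)) quotient_variety quotient_variety"
proof -
  have "(rel_variety P ===> (P ===> P) ===> rel_set (rel_set P) ===> (=))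
    (\<lambda>V s U. U \<subseteq> (\<lambda>P. {P, s P}) ` topspace (vtop V) \<and> openin (vtop V) {P \<in> topspace (vtop V). {P, s P} \<in> U})
    (\<lambda>V s U. U \<subseteq> (\<lambda>P. {P, s P}) ` topspace (vtop V) \<and> openin (vtop V) {P \<in> topspace (vtop V). {P, s P} \<in> U})"
    by transfer_prover
  moreover have "(rel_variety P ===> (P ===> P) ===> rel_set (rel_set P) ===> rel_set (rel_set P ===> (=)))
    (\<lambda>V s. vreg (quotient_variety V s)) (\<lambda>V s. vreg (quotient_variety V s))"
    unfolding quotient_variety_def variety.select_convs by transfer_prover
  ultimately show ?thesis
    by (simp add: rel_fun_def rel_topology_def rel_variety_def openin_quotient_variety)
qed

section \<open>Irreducibility, local rings, Du Val points, pluricanonical forms and numerical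
  invariants\<close>

lemma irreducible_variety_transfer [transfer_rule]:
  assumes [transfer_rule]: "bi_unique P" "bi_total P"
  shows "(rel_variety P ===> (=)) irreducible_variety irreducible_variety"
  unfolding irreducible_variety_def by transfer_prover

lemma local_functions_transfer [transfer_rule]:
  assumes [transfer_rule]: "bi_unique P" "bi_total P"
  shows "(rel_variety P ===> P ===> rel_set (P ===> (=))) local_functions local_functions"
  unfolding local_functions_def by transfer_prover

text \<open>The inductive set is rewritten as the intersection of all sets closed under its three
  rules, for the same reason as in \<open>generate_topology_on_eq\<close>.\<close>

lemma max_ideal_power_eq:
  "max_ideal_power = (\<lambda>V p n. {h. \<forall>M.
      (\<forall>f g. g \<in> local_functions V p \<longrightarrow> (\<forall>i<n. f i \<in> local_functions V p \<and> f i p = 0) \<longrightarrow>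
         (\<lambda>q. g q * (\<Prod>i<n. f i q)) \<in> M) \<and>
      (\<forall>f g. f \<in> M \<longrightarrow> g \<in> M \<longrightarrow> (\<lambda>q. f q + g q) \<in> M) \<and>
      (\<forall>f g U. f \<in> M \<longrightarrow> openin (vtop V) U \<longrightarrow> p \<in> U \<longrightarrow> (\<forall>q\<in>U. g q = f q) \<longrightarrow> g \<in> M) \<longrightarrow>
      h \<in> M})"
proof (rule ext)+
  fix V :: "'a variety" and p and n :: nat
  let ?C = "\<lambda>M. (\<forall>f g. g \<in> local_functions V p \<longrightarrow>
         (\<forall>i<n. f i \<in> local_functions V p \<and> f i p = 0) \<longrightarrow> (\<lambda>q. g q * (\<Prod>i<n. f i q)) \<in> M) \<and>
      (\<forall>f g. f \<in> M \<longrightarrow> g \<in> M \<longrightarrow> (\<lambda>q. f q + g q) \<in> M) \<and>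
      (\<forall>f g U. f \<in> M \<longrightarrow> openin (vtop V) U \<longrightarrow> p \<in> U \<longrightarrow> (\<forall>q\<in>U. g q = f q) \<longrightarrow> g \<in> M)"
  have 1: "h \<in> M" if "h \<in> max_ideal_power V p n"
    and M: "\<forall>f g. g \<in> local_functions V p \<longrightarrow>
        (\<forall>i<n. f i \<in> local_functions V p \<and> f i p = 0) \<longrightarrow> (\<lambda>q. g q * (\<Prod>i<n. f i q)) \<in> M"
      "\<forall>f g. f \<in> M \<longrightarrow> g \<in> M \<longrightarrow> (\<lambda>q. f q + g q) \<in> M"
      "\<forall>f g U. f \<in> M \<longrightarrow> openin (vtop V) U \<longrightarrow> p \<in> U \<longrightarrow> (\<forall>q\<in>U. g q = f q) \<longrightarrow> g \<in> M" for h M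
    using that(1)
  proof (induction rule: max_ideal_power.induct)
    case (prod g f)
    with M(1)[rule_format, of g f] show ?case by simp
  next
    case (add f g)
    with M(2)[rule_format, of f g] show ?case by simp
  next
    case (germ f U g)
    with M(3)[rule_format, of f U g] show ?case by simp
  qed
  have 2: "?C (max_ideal_power V p n)"
    by (intro conjI allI impI; rule max_ideal_power.intros; assumption)
  show "max_ideal_power V p n = {h. \<forall>M. ?C M \<longrightarrow> h \<in> M}"
  proof (rule Set.set_eqI, rule iffI)
    fix h assume h: "h \<in> max_ideal_power V p n"
    show "h \<in> {h. \<forall>M. ?C M \<longrightarrow> h \<in> M}"
      by (intro CollectI allI impI, elim conjE) (rule 1[OF h])
  next
    fix h assume "h \<in> {h. \<forall>M. ?C M \<longrightarrow> h \<in> M}"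
    then have "?C (max_ideal_power V p n) \<longrightarrow> h \<in> max_ideal_power V p n"
      by (elim CollectE allE)
    with 2 show "h \<in> max_ideal_power V p n" by (rule rev_mp)
  qed
qed

lemma max_ideal_power_transfer [transfer_rule]:
  assumes [transfer_rule]: "bi_unique P" "bi_total P"
  shows "(rel_variety P ===> P ===> (=) ===> rel_set (P ===> (=))) max_ideal_power max_ideal_power"
  unfolding max_ideal_power_eq by transfer_prover

text \<open>Power series do not involve the points of the variety, so they are related by equality;
  only the representatives of germs in the domain of \<theta> are moved.\<close>

lemma completion_is_hypersurface_transfer [transfer_rule]:
  assumes [transfer_rule]: "bi_unique P" "bi_total P"
  shows "(rel_variety P ===> P ===> (=) ===> (=)) completion_is_hypersurface completion_is_hypersurface"
  unfolding completion_is_hypersurface_def by transfer_prover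

lemma smooth_or_du_val_transfer [transfer_rule]:
  assumes [transfer_rule]: "bi_unique P" "bi_total P"
  shows "(rel_variety P ===> (=)) smooth_or_du_val smooth_or_du_val"
  unfolding smooth_or_du_val_def by transfer_prover

lemma differential_at_transfer [transfer_rule]:
  assumes [transfer_rule]: "bi_unique P" "bi_total P"
  shows "(rel_variety P ===> P ===> (P ===> (=)) ===> (P ===> (=)) ===> (P ===> (=)) ===>
      (=) ===> (=) ===> (=))
    differential_at differential_at"
  unfolding differential_at_def by transfer_prover

lemma local_parameters_transfer [transfer_rule]:
  assumes [transfer_rule]: "bi_unique P" "bi_total P"
  shows "(rel_variety P ===> P ===> (P ===> (=)) ===> (P ===> (=)) ===> (=))
    local_parameters local_parameters"
  unfolding local_parameters_def by transfer_prover

lemma pluricanonical_forms_transfer [transfer_rule]: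
  assumes [transfer_rule]: "bi_unique P" "bi_total P"
  shows "(rel_variety P ===> (=) ===>
      rel_set (rel_prod P (rel_prod (P ===> (=)) (P ===> (=))) ===> (=)))
    pluricanonical_forms pluricanonical_forms"
  unfolding pluricanonical_forms_def by transfer_prover

lemma has_complex_dim_transfer [transfer_rule]:
  assumes [transfer_rule]: "bi_unique Z" "bi_total Z"
  shows "(rel_set (Z ===> (=)) ===> (=) ===> (=)) has_complex_dim has_complex_dim"
  unfolding has_complex_dim_def by transfer_prover

lemma nonvanishing_locus_transfer [transfer_rule]:
  assumes [transfer_rule]: "bi_unique P" "bi_total P"
  shows "(rel_variety P ===> (rel_prod P (rel_prod (P ===> (=)) (P ===> (=))) ===> (=)) ===> rel_set P)
    nonvanishing_locus nonvanishing_locus"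
  unfolding nonvanishing_locus_def by transfer_prover

lemma canonical_class_ample_transfer [transfer_rule]:
  assumes [transfer_rule]: "bi_unique P" "bi_total P"
  shows "(rel_variety P ===> (=)) canonical_class_ample canonical_class_ample"
  unfolding canonical_class_ample_def by transfer_prover

lemma canonical_model_general_type_transfer [transfer_rule]:
  assumes [transfer_rule]: "bi_unique P" "bi_total P"
  shows "(rel_variety P ===> (=)) canonical_model_general_type canonical_model_general_type"
  unfolding canonical_model_general_type_def by transfer_prover

lemma has_geometric_genus_transfer [transfer_rule]:
  assumes [transfer_rule]: "bi_unique P" "bi_total P"
  shows "(rel_variety P ===> (=) ===> (=)) has_geometric_genus has_geometric_genus"
  unfolding has_geometric_genus_def by transfer_prover

lemma irregularity_zero_transfer [transfer_rule]:
  assumes [transfer_rule]: "bi_unique P" "bi_total P"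
  shows "(rel_variety P ===> (=)) irregularity_zero irregularity_zero"
  unfolding irregularity_zero_def by transfer_prover

lemma has_canonical_degree_transfer [transfer_rule]:
  assumes [transfer_rule]: "bi_unique P" "bi_total P"
  shows "(rel_variety P ===> (=) ===> (=)) has_canonical_degree has_canonical_degree"
  unfolding has_canonical_degree_def by transfer_prover

end

text \<open>The relation is the graph of a bijection \<open>e\<close>, and every relator then
  becomes a statement about images under \<open>e\<close> or composition with
  \<open>e\<close>.\<close>

lemma rel_variety_imp_isomorphic:
  assumes P: "bi_unique P" "bi_total P" and V: "rel_variety P V V'"
  shows "isomorphic_varieties V V'"
proof -
  \<comment> \<open>Left totality and right uniqueness give the function; the other two halves of
    the hypotheses give injectivity and surjectivity below.\<close>
  obtain e where e: "\<And>x y. P x y \<longleftrightarrow> y = e x"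
    using P unfolding bi_unique_def bi_total_def by metis
  have inj: "inj e"
    using P(1) unfolding bi_unique_def e by (auto intro: injI)
  have surj: "surj e"
    using P(2) unfolding bi_total_def e by (auto simp: surj_def)
  have set: "rel_set P A B \<longleftrightarrow> B = e ` A" for A B
    unfolding rel_set_def e by auto
  have op: "openin (vtop V') (e ` U) \<longleftrightarrow> openin (vtop V) U" for U
    using V unfolding rel_variety_def rel_topology_def rel_fun_def set by auto
  have top: "topspace (vtop V') = e ` topspace (vtop V)"
    using V topspace_transfer[OF P] unfolding rel_variety_def rel_fun_def set by auto
  have fn: "rel_fun P (=) f g \<longleftrightarrow> f = g \<circ> e" for f :: "_ \<Rightarrow> complex" and g
    unfolding rel_fun_def e by auto
  have reg: "rel_set (rel_fun P (=)) (vreg V U) (vreg V' (e ` U))" for U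
    using V unfolding rel_variety_def rel_fun_def set by auto
  have "homeomorphic_map (vtop V) (vtop V') e"
    unfolding homeomorphic_map_def quotient_map_def
  proof (intro conjI allI impI)
    fix U assume "U \<subseteq> topspace (vtop V')"
    then have "e ` {P \<in> topspace (vtop V). e P \<in> U} = U"
      unfolding top by auto
    then show "openin (vtop V) {P \<in> topspace (vtop V). e P \<in> U} = openin (vtop V') U"
      by (metis op)
  qed (use inj top in \<open>auto simp: inj_on_def\<close>)
  moreover have "f \<in> vreg V' U \<longleftrightarrow> f \<circ> e \<in> vreg V {P \<in> topspace (vtop V). e P \<in> U}"
    if "openin (vtop V') U" for U f
  proof -
    have U: "e ` {P \<in> topspace (vtop V). e P \<in> U} = U"
      using openin_subset[OF that] unfolding top by auto
    \<comment> \<open>The relator yields only some regular \<open>g\<close> with the same pullback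
      as \<open>f\<close>. Since \<open>e\<close> is onto the whole type, the two total functions
      are equal.\<close>
    have "g = f" if "g \<circ> e = f \<circ> e" for g
      using that surj by (metis surj_fun_eq)
    then show ?thesis
      using reg[of "{P \<in> topspace (vtop V). e P \<in> U}"] unfolding U rel_set_def fn by metis
  qed
  ultimately show ?thesis
    unfolding isomorphic_varieties_def by blast
qed

section \<open>Parametricity of rings, fraction fields and Proj\<close>

text \<open>The operations are related on the whole type rather than on the carrier alone, so each
  record field has an unconditional transfer rule.\<close>

definition rel_ring :: "('a \<Rightarrow> 'b \<Rightarrow> bool) \<Rightarrow> 'a ring \<Rightarrow> 'b ring \<Rightarrow> bool" where
  "rel_ring A R S \<longleftrightarrow> rel_set A (carrier R) (carrier S) \<and>
     rel_fun A (rel_fun A A) (monoid.mult R) (monoid.mult S) \<and> A (one R) (one S) \<and>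
     A (zero R) (zero S) \<and> rel_fun A (rel_fun A A) (add R) (add S)"

text \<open>Lets a fixed ring be related to itself by equality, as is required for the complex
  numbers as the target of the homomorphisms in \<open>proj_coords\<close>.\<close>

lemma rel_ring_eq [relator_eq]: "rel_ring (=) = (=)"
  by (auto simp: rel_ring_def rel_set_eq rel_fun_eq fun_eq_iff)

definition mk_ring :: "'a set \<Rightarrow> ('a \<Rightarrow> 'a \<Rightarrow> 'a) \<Rightarrow> 'a \<Rightarrow> 'a \<Rightarrow> ('a \<Rightarrow> 'a \<Rightarrow> 'a) \<Rightarrow> 'a ring" where
  "mk_ring c m u z a = \<lparr>carrier = c, monoid.mult = m, one = u, zero = z, add = a\<rparr>"

text \<open>Stated by bounded quantifiers over the record fields, with negatives as an existential,
  being a ring is visibly parametric; the locale predicate hides this behind auxiliary structures.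
  The remaining one-sided laws follow from commutativity of addition.\<close>

lemma ring_iff:
  fixes R (structure)
  shows "ring R \<longleftrightarrow> \<zero> \<in> carrier R \<and> \<one> \<in> carrier R \<and>
     (\<forall>x\<in>carrier R. \<zero> \<oplus> x = x \<and> \<one> \<otimes> x = x \<and> x \<otimes> \<one> = x \<and> (\<exists>y\<in>carrier R. y \<oplus> x = \<zero>)) \<and>
     (\<forall>x\<in>carrier R. \<forall>y\<in>carrier R. x \<oplus> y \<in> carrier R \<and> x \<otimes> y \<in> carrier R \<and> x \<oplus> y = y \<oplus> x) \<and>
     (\<forall>x\<in>carrier R. \<forall>y\<in>carrier R. \<forall>z\<in>carrier R.
        x \<oplus> y \<oplus> z = x \<oplus> (y \<oplus> z) \<and> x \<otimes> y \<otimes> z = x \<otimes> (y \<otimes> z) \<and>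
        (x \<oplus> y) \<otimes> z = x \<otimes> z \<oplus> y \<otimes> z \<and> z \<otimes> (x \<oplus> y) = z \<otimes> x \<oplus> z \<otimes> y)" (is "_ \<longleftrightarrow> ?r")
proof
  assume "ring R"
  then interpret ring R .
  show ?r
    by (auto simp: a_ac m_assoc l_distr r_distr intro!: bexI[of _ "\<ominus> x" for x] l_neg)
next
  assume ?r
  then show "ring R"
    by (intro ringI abelian_groupI monoidI) auto
qed

lemma cring_iff:
  fixes R (structure)
  shows "cring R \<longleftrightarrow> ring R \<and> (\<forall>x\<in>carrier R. \<forall>y\<in>carrier R. x \<otimes> y = y \<otimes> x)"
  by (auto simp: cring_def comm_monoid_axioms_def comm_monoid_def ring.is_monoid
      intro: comm_monoid.m_comm)

text \<open>Closure under negatives follows from absorption, as a negative is the product with the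
  negative of the unit.\<close>

lemma ideal_iff:
  fixes R (structure)
  shows "ideal I R \<longleftrightarrow> ring R \<and> I \<subseteq> carrier R \<and> \<zero> \<in> I \<and> (\<forall>a\<in>I. \<forall>b\<in>I. a \<oplus> b \<in> I) \<and>
     (\<forall>a\<in>I. \<forall>x\<in>carrier R. x \<otimes> a \<in> I \<and> a \<otimes> x \<in> I)" (is "_ \<longleftrightarrow> ?r")
proof
  assume "ideal I R"
  then interpret ideal I R .
  show ?r
    using ring_axioms a_subset I_l_closed I_r_closed by auto
next
  assume r: ?r
  then interpret ring R by simp
  have "\<ominus> a \<in> I" if "a \<in> I" for a
  proof -
    have "\<ominus> a = \<ominus> \<one> \<otimes> a" using that r by (auto simp: l_minus)
    then show ?thesis using that r by auto
  qed
  then have "subgroup I (add_monoid R)"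
    using r by unfold_locales (auto simp: a_inv_def)
  then show "ideal I R"
    using r by (intro idealI) auto
qed

lemma primeideal_iff:
  fixes R (structure)
  shows "primeideal I R \<longleftrightarrow> ideal I R \<and> cring R \<and> carrier R \<noteq> I \<and>
     (\<forall>a\<in>carrier R. \<forall>b\<in>carrier R. a \<otimes> b \<in> I \<longrightarrow> a \<in> I \<or> b \<in> I)"
  by (auto simp: primeideal_def primeideal_axioms_def)

text \<open>The generated ring is the intersection of all sets closed under its rules. Negatives are
  expressed by the equation \<open>b \<oplus> a = \<zero>\<close> inside the carrier, which avoids
  the definite description behind \<open>a_inv\<close>.\<close>

lemma generate_ring_eq:
  fixes R (structure)
  assumes "ring R" "H \<subseteq> carrier R"
  shows "generate_ring R H = {x. \<forall>M. \<one> \<in> M \<and> H \<subseteq> M \<and>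
     (\<forall>a\<in>M. \<forall>b\<in>M. a \<oplus> b \<in> M \<and> a \<otimes> b \<in> M) \<and>
     (\<forall>a\<in>M \<inter> carrier R. \<forall>b\<in>carrier R. b \<oplus> a = \<zero> \<longrightarrow> b \<in> M) \<longrightarrow> x \<in> M}"
    (is "_ = {x. \<forall>M. ?C M \<longrightarrow> x \<in> M}")
proof -
  interpret ring R by fact
  have gc: "h \<in> carrier R" if "h \<in> generate_ring R H" for h
    using generate_ring_in_carrier[OF assms(2) that] .
  have "h \<in> M" if "h \<in> generate_ring R H" "?C M" for h M
    using that
  proof (induction rule: generate_ring.induct)
    case (a_inv h)
    then have "h \<in> M" "h \<in> carrier R" using gc by auto
    moreover have "\<ominus> h \<in> carrier R" "\<ominus> h \<oplus> h = \<zero>"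
      using \<open>h \<in> carrier R\<close> by (auto intro: l_neg)
    ultimately show ?case using a_inv.prems by blast
  qed auto
  moreover have "b \<in> generate_ring R H"
    if "a \<in> generate_ring R H" "b \<in> carrier R" "b \<oplus> a = \<zero>" for a b
    using that gc generate_ring.a_inv[OF that(1)] minus_equality by metis
  then have "?C (generate_ring R H)"
    by (auto intro: generate_ring.intros)
  ultimately show ?thesis by blast
qed

context
  includes lifting_syntax
begin

lemma Sigma_transfer [transfer_rule]:
  "(rel_set A ===> (A ===> rel_set B) ===> rel_set (rel_prod A B)) Sigma Sigma"
  unfolding Sigma_def by transfer_prover

lemma carrier_transfer [transfer_rule]: "(rel_ring A ===> rel_set A) carrier carrier"
  by (simp add: rel_fun_def rel_ring_def)

lemma mult_transfer [transfer_rule]: "(rel_ring A ===> A ===> A ===> A) monoid.mult monoid.mult"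
  by (simp add: rel_fun_def rel_ring_def)

lemma one_transfer [transfer_rule]: "(rel_ring A ===> A) monoid.one monoid.one"
  by (simp add: rel_fun_def rel_ring_def)

lemma zero_transfer [transfer_rule]: "(rel_ring A ===> A) ring.zero ring.zero"
  by (simp add: rel_fun_def rel_ring_def)

lemma add_transfer [transfer_rule]: "(rel_ring A ===> A ===> A ===> A) ring.add ring.add"
  by (simp add: rel_fun_def rel_ring_def)

lemma mk_ring_transfer [transfer_rule]:
  "(rel_set A ===> (A ===> A ===> A) ===> A ===> A ===> (A ===> A ===> A) ===> rel_ring A) mk_ring mk_ring"
  by (simp add: rel_fun_def rel_ring_def mk_ring_def)

lemma carrier_update_transfer [transfer_rule]:
  "((rel_set A ===> rel_set A) ===> rel_ring A ===> rel_ring A) carrier_update carrier_update"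
  by (simp add: rel_fun_def rel_ring_def)

lemma ring_transfer [transfer_rule]:
  assumes [transfer_rule]: "bi_unique A" "bi_total A"
  shows "(rel_ring A ===> (=)) ring ring"
  unfolding ring_iff by transfer_prover

lemma cring_transfer [transfer_rule]:
  assumes [transfer_rule]: "bi_unique A" "bi_total A"
  shows "(rel_ring A ===> (=)) cring cring"
  unfolding cring_iff by transfer_prover

lemma ideal_transfer [transfer_rule]:
  assumes [transfer_rule]: "bi_unique A" "bi_total A"
  shows "(rel_set A ===> rel_ring A ===> (=)) ideal ideal"
  unfolding ideal_iff by transfer_prover

lemma primeideal_transfer [transfer_rule]:
  assumes [transfer_rule]: "bi_unique A" "bi_total A"
  shows "(rel_set A ===> rel_ring A ===> (=)) primeideal primeideal"
  unfolding primeideal_iff by transfer_prover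

lemma genideal_transfer [transfer_rule]:
  assumes [transfer_rule]: "bi_unique A" "bi_total A"
  shows "(rel_ring A ===> rel_set A ===> rel_set A) genideal genideal"
  unfolding genideal_def by transfer_prover

lemma generate_ring_transfer:
  assumes A [transfer_rule]: "bi_unique A" "bi_total A"
    and [transfer_rule]: "rel_ring A R S" "rel_set A H K"
    and "ring R" "H \<subseteq> carrier R"
  shows "rel_set A (generate_ring R H) (generate_ring S K)"
proof -
  have "ring S" "K \<subseteq> carrier S"
    using assms(5,6) by (transfer, simp)+
  show ?thesis
    unfolding generate_ring_eq[OF assms(5,6)] generate_ring_eq[OF \<open>ring S\<close> \<open>K \<subseteq> carrier S\<close>]
    by transfer_prover
qed

lemma a_r_coset_transfer [transfer_rule]:
  assumes [transfer_rule]: "bi_unique A" "bi_total A"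
  shows "(rel_ring A ===> rel_set A ===> A ===> rel_set A) a_r_coset a_r_coset"
  unfolding a_r_coset_def r_coset_def partial_object.simps monoid.simps by transfer_prover

lemma FactRing_transfer [transfer_rule]:
  assumes [transfer_rule]: "bi_unique A" "bi_total A"
  shows "(rel_ring A ===> rel_set A ===> rel_ring (rel_set A)) FactRing FactRing"
  unfolding FactRing_def mk_ring_def[symmetric] A_RCOSETS_def RCOSETS_def rcoset_mult_def set_add_def
    set_mult_def a_r_coset_def[symmetric] partial_object.simps monoid.simps by transfer_prover

lemma frac_class_transfer [transfer_rule]:
  assumes [transfer_rule]: "bi_unique A" "bi_total A"
  shows "(rel_ring A ===> A ===> A ===> rel_set (rel_prod A A)) frac_class frac_class"
  unfolding frac_class_def by transfer_prover

lemma frac_field_transfer [transfer_rule]: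
  assumes [transfer_rule]: "bi_unique A" "bi_total A"
  shows "(rel_ring A ===> rel_ring (rel_set (rel_prod A A))) frac_field frac_field"
  unfolding frac_field_def mk_ring_def[symmetric] by transfer_prover

lemma ring_hom_transfer [transfer_rule]:
  assumes [transfer_rule]: "bi_unique A" "bi_total A" "bi_unique B" "bi_total B"
  shows "(rel_ring A ===> rel_ring B ===> rel_set (A ===> B)) ring_hom ring_hom"
  unfolding ring_hom_def Pi_def by transfer_prover

lemma proj_coords_transfer [transfer_rule]:
  assumes [transfer_rule]: "bi_unique A" "bi_total A"
  shows "(rel_ring A ===> ((=) ===> A) ===> ((=) ===> rel_set A) ===> rel_set (A ===> (=)))
    proj_coords proj_coords"
  unfolding proj_coords_def extensional_def by transfer_prover

lemma proj_points_transfer [transfer_rule]: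
  assumes [transfer_rule]: "bi_unique A" "bi_total A"
  shows "(rel_ring A ===> ((=) ===> A) ===> ((=) ===> rel_set A) ===> rel_set (rel_set (A ===> (=))))
    proj_points proj_points"
  unfolding proj_points_def by transfer_prover

end

section \<open>Arithmetic in the fraction field of a domain\<close>

context
  fixes R :: "'a ring" (structure)
  assumes domain: "domain R"
begin

interpretation domain R by (rule domain)

lemma mem_frac_class:
  "(c, d) \<in> frac_class R a b \<longleftrightarrow> c \<in> carrier R \<and> d \<in> carrier R \<and> d \<noteq> \<zero> \<and> a \<otimes> d = c \<otimes> b"
  by (auto simp: frac_class_def)

text \<open>Transitivity of equality of fractions: multiply by the middle denominator
  \<open>d\<close> and cancel it.\<close>

lemma frac_class_trans:
  assumes "a \<in> carrier R" "b \<in> carrier R" "c \<in> carrier R" "d \<in> carrier R" "d \<noteq> \<zero>"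
    and "e \<in> carrier R" "f \<in> carrier R" "a \<otimes> d = c \<otimes> b" "c \<otimes> f = e \<otimes> d"
  shows "a \<otimes> f = e \<otimes> b"
proof -
  have "d \<otimes> (a \<otimes> f) = (a \<otimes> d) \<otimes> f" using assms(1-7) by (simp add: m_ac)
  also have "\<dots> = (c \<otimes> f) \<otimes> b" unfolding assms(8) using assms(1-7) by (simp add: m_ac)
  also have "\<dots> = d \<otimes> (e \<otimes> b)" unfolding assms(9) using assms(1-7) by (simp add: m_ac)
  finally show ?thesis using assms m_lcancel by simp
qed

lemma frac_class_eq_iff:
  assumes "a \<in> carrier R" "b \<in> carrier R" "b \<noteq> \<zero>" "c \<in> carrier R" "d \<in> carrier R" "d \<noteq> \<zero>"
  shows "frac_class R a b = frac_class R c d \<longleftrightarrow> a \<otimes> d = c \<otimes> b"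
proof
  assume "frac_class R a b = frac_class R c d"
  moreover have "(c, d) \<in> frac_class R c d" using assms by (simp add: mem_frac_class)
  ultimately show "a \<otimes> d = c \<otimes> b" by (metis mem_frac_class)
next
  assume eq: "a \<otimes> d = c \<otimes> b"
  show "frac_class R a b = frac_class R c d"
  proof (rule Set.set_eqI, clarify)
    fix e f
    show "(e, f) \<in> frac_class R a b \<longleftrightarrow> (e, f) \<in> frac_class R c d"
      unfolding mem_frac_class
      by (blast intro: frac_class_trans[OF assms(4,5,1,2,3) _ _ eq[symmetric]]
          frac_class_trans[OF assms(1,2,4,5,6) _ _ eq])
  qed
qed

lemma frac_field_mult:
  "p \<otimes>\<^bsub>frac_field R\<^esub> q =
     (\<Union>x\<in>p \<times> q. frac_class R (fst (fst x) \<otimes> fst (snd x)) (snd (fst x) \<otimes> snd (snd x)))"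
  by (simp add: frac_field_def case_prod_beta)

lemma frac_field_add:
  "p \<oplus>\<^bsub>frac_field R\<^esub> q =
     (\<Union>x\<in>p \<times> q. frac_class R (fst (fst x) \<otimes> snd (snd x) \<oplus> fst (snd x) \<otimes> snd (fst x))
        (snd (fst x) \<otimes> snd (snd x)))"
  by (simp add: frac_field_def case_prod_beta)

text \<open>By definition the product is a union over all pairs of representatives. All members of
  this union coincide and there is at least one, so the union is a single class.\<close>

lemma frac_class_mult:
  assumes "a \<in> carrier R" "b \<in> carrier R" "b \<noteq> \<zero>" "c \<in> carrier R" "d \<in> carrier R" "d \<noteq> \<zero>"
  shows "frac_class R a b \<otimes>\<^bsub>frac_field R\<^esub> frac_class R c d = frac_class R (a \<otimes> c) (b \<otimes> d)"
proof -
  have *: "frac_class R (a' \<otimes> c') (b' \<otimes> d') = frac_class R (a \<otimes> c) (b \<otimes> d)"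
    if "(a', b') \<in> frac_class R a b" "(c', d') \<in> frac_class R c d" for a' b' c' d'
  proof -
    have car: "a' \<in> carrier R" "b' \<in> carrier R" "b' \<noteq> \<zero>" "c' \<in> carrier R" "d' \<in> carrier R" "d' \<noteq> \<zero>"
      and eq: "a \<otimes> b' = a' \<otimes> b" "c \<otimes> d' = c' \<otimes> d"
      using that by (auto simp: mem_frac_class)
    have "(a' \<otimes> c') \<otimes> (b \<otimes> d) = (a' \<otimes> b) \<otimes> (c' \<otimes> d)" using car assms by (simp add: m_ac)
    also have "\<dots> = (a \<otimes> c) \<otimes> (b' \<otimes> d')" unfolding eq[symmetric] using car assms by (simp add: m_ac)
    finally show ?thesis
      using car assms by (subst frac_class_eq_iff) (auto simp: integral_iff)
  qed
  have mem: "(a, b) \<in> frac_class R a b" "(c, d) \<in> frac_class R c d"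
    using assms by (auto simp: mem_frac_class)
  show ?thesis
    unfolding frac_field_mult
  proof (rule SUP_eq_const)
    fix x assume x: "x \<in> frac_class R a b \<times> frac_class R c d"
    show "frac_class R (fst (fst x) \<otimes> fst (snd x)) (snd (fst x) \<otimes> snd (snd x)) =
      frac_class R (a \<otimes> c) (b \<otimes> d)"
      by (rule *) (use x in auto)
  qed (use mem in blast)
qed

lemma frac_class_add:
  assumes "a \<in> carrier R" "b \<in> carrier R" "b \<noteq> \<zero>" "c \<in> carrier R" "d \<in> carrier R" "d \<noteq> \<zero>"
  shows "frac_class R a b \<oplus>\<^bsub>frac_field R\<^esub> frac_class R c d = frac_class R (a \<otimes> d \<oplus> c \<otimes> b) (b \<otimes> d)"
proof -
  have *: "frac_class R (a' \<otimes> d' \<oplus> c' \<otimes> b') (b' \<otimes> d') = frac_class R (a \<otimes> d \<oplus> c \<otimes> b) (b \<otimes> d)"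
    if "(a', b') \<in> frac_class R a b" "(c', d') \<in> frac_class R c d" for a' b' c' d'
  proof -
    have car: "a' \<in> carrier R" "b' \<in> carrier R" "b' \<noteq> \<zero>" "c' \<in> carrier R" "d' \<in> carrier R" "d' \<noteq> \<zero>"
      and eq: "a \<otimes> b' = a' \<otimes> b" "c \<otimes> d' = c' \<otimes> d"
      using that by (auto simp: mem_frac_class)
    have "(a' \<otimes> d' \<oplus> c' \<otimes> b') \<otimes> (b \<otimes> d) = (a' \<otimes> b) \<otimes> (d \<otimes> d') \<oplus> (c' \<otimes> d) \<otimes> (b \<otimes> b')"
      using car assms by (simp add: m_ac l_distr r_distr)
    also have "\<dots> = (a \<otimes> d \<oplus> c \<otimes> b) \<otimes> (b' \<otimes> d')"
      unfolding eq[symmetric] using car assms by (simp add: m_ac l_distr r_distr)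
    finally show ?thesis
      using car assms by (subst frac_class_eq_iff) (auto simp: integral_iff)
  qed
  have mem: "(a, b) \<in> frac_class R a b" "(c, d) \<in> frac_class R c d"
    using assms by (auto simp: mem_frac_class)
  show ?thesis
    unfolding frac_field_add
  proof (rule SUP_eq_const)
    fix x assume x: "x \<in> frac_class R a b \<times> frac_class R c d"
    show "frac_class R (fst (fst x) \<otimes> snd (snd x) \<oplus> fst (snd x) \<otimes> snd (fst x))
        (snd (fst x) \<otimes> snd (snd x)) = frac_class R (a \<otimes> d \<oplus> c \<otimes> b) (b \<otimes> d)"
      by (rule *) (use x in auto)
  qed (use mem in blast)
qed

lemma frac_class_closed [simp]:
  assumes "a \<in> carrier R" "b \<in> carrier R" "b \<noteq> \<zero>"
  shows "frac_class R a b \<in> carrier (frac_field R)"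
  using assms by (auto simp: frac_field_def)

lemma frac_field_cases:
  assumes "q \<in> carrier (frac_field R)"
  obtains a b where "a \<in> carrier R" "b \<in> carrier R" "b \<noteq> \<zero>" "q = frac_class R a b"
  using assms by (auto simp: frac_field_def)

lemma frac_field_one: "\<one>\<^bsub>frac_field R\<^esub> = frac_class R \<one> \<one>"
  and frac_field_zero: "\<zero>\<^bsub>frac_field R\<^esub> = frac_class R \<zero> \<one>"
  by (simp_all add: frac_field_def)

text \<open>Once representatives are chosen, each axiom is an identity between cross products in the
  domain.\<close>

lemma frac_field_cring: "cring (frac_field R)"
  unfolding cring_iff ring_iff
proof (intro conjI ballI)
  let ?K = "frac_field R"
  show "\<zero>\<^bsub>?K\<^esub> \<in> carrier ?K" "\<one>\<^bsub>?K\<^esub> \<in> carrier ?K"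
    by (simp_all add: frac_field_one frac_field_zero)
  note frac = frac_class_mult frac_class_add frac_class_eq_iff frac_field_one frac_field_zero
    integral_iff m_ac l_distr r_distr
  fix x assume "x \<in> carrier ?K"
  then obtain a b where ab: "a \<in> carrier R" "b \<in> carrier R" "b \<noteq> \<zero>" and x: "x = frac_class R a b"
    by (rule frac_field_cases)
  from ab show "\<zero>\<^bsub>?K\<^esub> \<oplus>\<^bsub>?K\<^esub> x = x" "\<one>\<^bsub>?K\<^esub> \<otimes>\<^bsub>?K\<^esub> x = x" "x \<otimes>\<^bsub>?K\<^esub> \<one>\<^bsub>?K\<^esub> = x"
    by (simp_all add: x frac)
  have "\<ominus> a \<otimes> b \<oplus> a \<otimes> b = \<zero>" using ab by (simp add: l_minus l_neg)
  with ab show "\<exists>y\<in>carrier ?K. y \<oplus>\<^bsub>?K\<^esub> x = \<zero>\<^bsub>?K\<^esub>"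
    by (intro bexI[of _ "frac_class R (\<ominus> a) b"]) (simp_all add: x frac)
  fix y assume "y \<in> carrier ?K"
  then obtain c d where cd: "c \<in> carrier R" "d \<in> carrier R" "d \<noteq> \<zero>" and y: "y = frac_class R c d"
    by (rule frac_field_cases)
  from ab cd show "x \<oplus>\<^bsub>?K\<^esub> y \<in> carrier ?K" "x \<otimes>\<^bsub>?K\<^esub> y \<in> carrier ?K" "x \<oplus>\<^bsub>?K\<^esub> y = y \<oplus>\<^bsub>?K\<^esub> x"
    "x \<otimes>\<^bsub>?K\<^esub> y = y \<otimes>\<^bsub>?K\<^esub> x"
    by (simp_all add: x y frac a_ac)
  fix z assume "z \<in> carrier ?K"
  then obtain e f where ef: "e \<in> carrier R" "f \<in> carrier R" "f \<noteq> \<zero>" and z: "z = frac_class R e f"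
    by (rule frac_field_cases)
  from ab cd ef show "x \<oplus>\<^bsub>?K\<^esub> y \<oplus>\<^bsub>?K\<^esub> z = x \<oplus>\<^bsub>?K\<^esub> (y \<oplus>\<^bsub>?K\<^esub> z)"
    "x \<otimes>\<^bsub>?K\<^esub> y \<otimes>\<^bsub>?K\<^esub> z = x \<otimes>\<^bsub>?K\<^esub> (y \<otimes>\<^bsub>?K\<^esub> z)"
    "(x \<oplus>\<^bsub>?K\<^esub> y) \<otimes>\<^bsub>?K\<^esub> z = x \<otimes>\<^bsub>?K\<^esub> z \<oplus>\<^bsub>?K\<^esub> y \<otimes>\<^bsub>?K\<^esub> z"
    "z \<otimes>\<^bsub>?K\<^esub> (x \<oplus>\<^bsub>?K\<^esub> y) = z \<otimes>\<^bsub>?K\<^esub> x \<oplus>\<^bsub>?K\<^esub> z \<otimes>\<^bsub>?K\<^esub> y"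
    by (simp_all add: x y z frac a_ac)
qed

end

section \<open>Substitution in polynomials\<close>

alias lookup = Poly_Mapping.lookup
alias keys = Poly_Mapping.keys
alias single = Poly_Mapping.single

lemma mconst_simps [simp]:
  "mconst 0 = 0" "mconst 1 = 1" "mconst (numeral n) = numeral n"
  "mconst (a + b) = mconst a + mconst b" "mconst (a - b) = mconst a - mconst b"
  "mconst (- a) = - mconst a" "mconst (a * b) = mconst a * mconst b"
  by (simp_all add: mconst_def single_add single_diff single_uminus mult_single)

lemma mconst_power [simp]: "mconst (a ^ n) = mconst a ^ n"
  by (induction n) simp_all

lemma mconst_prod: "mconst (\<Prod>i\<in>A. f i) = (\<Prod>i\<in>A. mconst (f i))"
  by (induction A rule: infinite_finite_induct) simp_all

lemma mconst_eq_0_iff [simp]: "mconst a = 0 \<longleftrightarrow> a = 0"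
  by (metis lookup_single_eq lookup_zero mconst_def mconst_simps(1))

text \<open>In the convolution that defines the product, only the exponent 0 of the constant
  contributes.\<close>

lemma lookup_mconst_mult: "lookup (mconst a * p) m = a * lookup p m"
proof -
  have "lookup (mconst a * p) m = prod_fun (lookup (mconst a)) (lookup p) m"
    by (simp add: times_poly_mapping.rep_eq)
  also have "\<dots> = (\<Sum>l. (a when 0 = l) * (\<Sum>q. (lookup p q when m = l + q)))"
    by (simp add: prod_fun_def mconst_def lookup_single)
  also have "\<dots> = (\<Sum>l. (a * (\<Sum>q. (lookup p q when m = l + q)) when l = 0))"
    by (intro arg_cong[of _ _ Sum_any] ext) (auto simp: when_def)
  also have "\<dots> = a * lookup p m" by simp
  finally show ?thesis .
qed

definition monom_subst :: "('v \<Rightarrow> 'w mpoly) \<Rightarrow> ('v \<Rightarrow>\<^sub>0 nat) \<Rightarrow> 'w mpoly" where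
  "monom_subst g m = (\<Prod>v\<in>keys m. g v ^ lookup m v)"

text \<open>Variables outside the support have exponent 0 and contribute the factor 1. Thus two
  monomials can be written over a common index set before they are multiplied.\<close>

lemma monom_subst_superset:
  assumes "finite S" "keys m \<subseteq> S"
  shows "monom_subst g m = (\<Prod>v\<in>S. g v ^ lookup m v)"
  unfolding monom_subst_def
  by (rule prod.mono_neutral_left) (use assms in \<open>auto simp: in_keys_iff\<close>)

lemma monom_subst_0 [simp]: "monom_subst g 0 = 1"
  by (simp add: monom_subst_def)

lemma monom_subst_add: "monom_subst g (m + n) = monom_subst g m * monom_subst g n"
proof -
  let ?S = "keys m \<union> keys n"
  have "monom_subst g (m + n) = (\<Prod>v\<in>?S. g v ^ lookup (m + n) v)"
    by (rule monom_subst_superset) (simp_all add: keys_add)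
  also have "\<dots> = (\<Prod>v\<in>?S. g v ^ lookup m v) * (\<Prod>v\<in>?S. g v ^ lookup n v)"
    by (simp add: lookup_add power_add prod.distrib)
  also have "\<dots> = monom_subst g m * monom_subst g n"
    by (simp add: monom_subst_superset[of ?S])
  finally show ?thesis .
qed

lemma msubst_superset:
  assumes "finite S" "keys p \<subseteq> S"
  shows "msubst g p = (\<Sum>m\<in>S. mconst (lookup p m) * monom_subst g m)"
  unfolding msubst_def monom_subst_def
  by (rule sum.mono_neutral_left) (use assms in \<open>auto simp: in_keys_iff\<close>)

lemma msubst_0 [simp]: "msubst g 0 = 0"
  by (simp add: msubst_def)

lemma msubst_single: "msubst g (single m a) = mconst a * monom_subst g m"
  by (subst msubst_superset[of "{m}"]) auto

lemma msubst_add [simp]: "msubst g (p + q) = msubst g p + msubst g q"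
proof -
  let ?S = "keys p \<union> keys q"
  have "msubst g (p + q) = (\<Sum>m\<in>?S. mconst (lookup (p + q) m) * monom_subst g m)"
    by (rule msubst_superset) (simp_all add: keys_add)
  also have "\<dots> = (\<Sum>m\<in>?S. mconst (lookup p m) * monom_subst g m) +
      (\<Sum>m\<in>?S. mconst (lookup q m) * monom_subst g m)"
    by (simp add: lookup_add distrib_right sum.distrib)
  also have "\<dots> = msubst g p + msubst g q"
    by (simp add: msubst_superset[of ?S])
  finally show ?thesis .
qed

lemma msubst_sum: "msubst g (\<Sum>i\<in>A. f i) = (\<Sum>i\<in>A. msubst g (f i))"
  by (induction A rule: infinite_finite_induct) simp_all

lemma mpoly_sum_monomials: "p = (\<Sum>m\<in>keys p. single m (lookup p m))"
proof (rule poly_mapping_eqI)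
  fix k
  show "lookup p k = lookup (\<Sum>m\<in>keys p. single m (lookup p m)) k"
    by (auto simp: lookup_sum lookup_single when_def in_keys_iff sum.delta)
qed

text \<open>By bilinearity it suffices to treat two monomials, where \<open>monom_subst_add\<close>
  turns the sum of exponents into a product.\<close>

lemma msubst_mult [simp]: "msubst g (p * q) = msubst g p * msubst g q"
proof -
  have single: "msubst g (single m a * single n b) =
      msubst g (single m a) * msubst g (single n b)" for m n a b
    by (simp add: mult_single msubst_single monom_subst_add algebra_simps)
  have "p * q = (\<Sum>m\<in>keys p. \<Sum>n\<in>keys q.
      single m (lookup p m) * single n (lookup q n))"
    by (subst mpoly_sum_monomials[of p], subst mpoly_sum_monomials[of q]) (simp add: sum_product)
  then have "msubst g (p * q) = (\<Sum>m\<in>keys p. \<Sum>n\<in>keys q.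
      msubst g (single m (lookup p m)) * msubst g (single n (lookup q n)))"
    by (simp add: msubst_sum single)
  also have "\<dots> = msubst g (\<Sum>m\<in>keys p. single m (lookup p m)) *
      msubst g (\<Sum>n\<in>keys q. single n (lookup q n))"
    by (simp add: msubst_sum sum_product)
  finally show ?thesis
    by (simp flip: mpoly_sum_monomials)
qed

lemma msubst_mconst [simp]: "msubst g (mconst c) = mconst c"
  by (simp add: mconst_def msubst_single)

lemma msubst_1 [simp]: "msubst g 1 = 1"
  using msubst_mconst[of g 1] by simp

lemma msubst_numeral [simp]: "msubst g (numeral n) = numeral n"
  using msubst_mconst[of g "numeral n"] by simp

lemma msubst_mvar [simp]: "msubst g (mvar v) = g v"
  by (simp add: mvar_def msubst_single monom_subst_def)

lemma msubst_uminus [simp]: "msubst g (- p) = - msubst g p"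
  using msubst_add[of g p "- p"] by (simp add: eq_neg_iff_add_eq_0 add.commute)

lemma msubst_diff [simp]: "msubst g (p - q) = msubst g p - msubst g q"
  using msubst_add[of g p "- q"] by simp

lemma msubst_power [simp]: "msubst g (p ^ n) = msubst g p ^ n"
  by (induction n) simp_all

lemma msubst_prod: "msubst g (\<Prod>i\<in>A. f i) = (\<Prod>i\<in>A. msubst g (f i))"
  by (induction A rule: infinite_finite_induct) simp_all

lemma msubst_msubst: "msubst g (msubst h p) = msubst (\<lambda>v. msubst g (h v)) p"
  unfolding msubst_def[of h] by (simp add: msubst_sum msubst_prod) (simp add: msubst_def)

lemma mvar_power: "mvar v ^ n = single (single v n) 1"
  by (induction n) (simp_all add: mvar_def mult_single flip: single_add)

lemma monom_subst_mvar: "monom_subst mvar m = single m 1"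
proof -
  have prod: "(\<Prod>v\<in>A. single (f v) (1::complex)) = single (\<Sum>v\<in>A. f v) 1"
    for A and f :: "'a \<Rightarrow> 'a \<Rightarrow>\<^sub>0 nat"
    by (induction A rule: infinite_finite_induct) (simp_all add: mult_single)
  have "(\<Sum>v\<in>keys m. single v (lookup m v)) = m"
    by (rule poly_mapping_eqI) (auto simp: lookup_sum lookup_single when_def in_keys_iff sum.delta)
  then show ?thesis by (simp add: monom_subst_def mvar_power prod)
qed

text \<open>The action of a diagonal matrix on polynomials.\<close>

definition scale_vars :: "('v \<Rightarrow> complex) \<Rightarrow> 'v mpoly \<Rightarrow> 'v mpoly" where
  "scale_vars c = msubst (\<lambda>v. mconst (c v) * mvar v)"

text \<open>Monomials are eigenvectors of a diagonal substitution. With nonzero weights the support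
  is therefore unchanged, which preserves homogeneity, and the inverse weights give the inverse
  map.\<close>

lemma lookup_scale_vars: "lookup (scale_vars c p) m = (\<Prod>v\<in>keys m. c v ^ lookup m v) * lookup p m"
proof -
  have mono: "monom_subst (\<lambda>v. mconst (c v) * mvar v) n =
      mconst (\<Prod>v\<in>keys n. c v ^ lookup n v) * single n 1" for n
    by (simp add: monom_subst_def power_mult_distrib prod.distrib mconst_prod flip: monom_subst_mvar)
  have "scale_vars c p = (\<Sum>n\<in>keys p. mconst (lookup p n) *
      (mconst (\<Prod>v\<in>keys n. c v ^ lookup n v) * single n 1))"
    unfolding scale_vars_def by (simp only: msubst_superset[OF finite_keys order_refl] mono)
  then have "lookup (scale_vars c p) m = (\<Sum>n\<in>keys p. lookup p n *
      ((\<Prod>v\<in>keys n. c v ^ lookup n v) * lookup (single n 1) m))"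
    by (simp only: lookup_sum lookup_mconst_mult)
  also have "\<dots> = (\<Sum>n\<in>keys p. if n = m
      then (\<Prod>v\<in>keys m. c v ^ lookup m v) * lookup p m else 0)"
    by (intro sum.cong) (auto simp: lookup_single)
  also have "\<dots> = (\<Prod>v\<in>keys m. c v ^ lookup m v) * lookup p m"
    by (auto simp: in_keys_iff)
  finally show ?thesis .
qed

lemma homogeneous_scale_vars:
  assumes "\<And>v. c v \<noteq> 0"
  shows "homogeneous wt d (scale_vars c p) \<longleftrightarrow> homogeneous wt d p"
proof -
  have "keys (scale_vars c p) = keys p"
    using assms by (auto simp: in_keys_iff lookup_scale_vars)
  then show ?thesis by (simp add: homogeneous_def)
qed

lemma bij_scale_vars:
  assumes "\<And>v. c v \<noteq> 0"
  shows "bij (scale_vars c)"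
proof (rule bij_betw_byWitness[where f' = "scale_vars (\<lambda>v. inverse (c v))"])
  have "lookup (scale_vars c (scale_vars (\<lambda>v. inverse (c v)) p)) m = lookup p m"
    "lookup (scale_vars (\<lambda>v. inverse (c v)) (scale_vars c p)) m = lookup p m" for p m
    using assms by (simp_all add: lookup_scale_vars flip: mult.assoc prod.distrib power_mult_distrib)
  then show "\<forall>p\<in>UNIV. scale_vars (\<lambda>v. inverse (c v)) (scale_vars c p) = p"
    "\<forall>p\<in>UNIV. scale_vars c (scale_vars (\<lambda>v. inverse (c v)) p) = p"
    by (auto intro: poly_mapping_eqI)
qed auto

lemma scale_vars_simps [simp]:
  "scale_vars c (p + q) = scale_vars c p + scale_vars c q"
  "scale_vars c (p - q) = scale_vars c p - scale_vars c q"
  "scale_vars c (p * q) = scale_vars c p * scale_vars c q"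
  "scale_vars c (- p) = - scale_vars c p"
  "scale_vars c (p ^ n) = scale_vars c p ^ n"
  "scale_vars c 0 = 0" "scale_vars c 1 = 1"
  "scale_vars c (mconst a) = mconst a"
  "scale_vars c (mvar v) = mconst (c v) * mvar v"
  by (simp_all add: scale_vars_def)

text \<open>The instance of \<open>idom\<close> for polynomials requires a linear order on the variables.\<close>

instantiation pvar :: linorder
begin

fun pvar_index :: "pvar \<Rightarrow> nat" where
  "pvar_index Px = 0" | "pvar_index Pu = 1" | "pvar_index Pv = 2"

definition less_eq_pvar where "v \<le> w \<longleftrightarrow> pvar_index v \<le> pvar_index w"
definition less_pvar where "v < w \<longleftrightarrow> pvar_index v < pvar_index w"

instance
proof
  fix v w :: pvar
  assume "v \<le> w" "w \<le> v"
  then show "v = w" by (cases v; cases w) (simp_all add: less_eq_pvar_def)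
qed (auto simp: less_eq_pvar_def less_pvar_def)

end

section \<open>The rescaling of \<open>y\<^sub>2\<close> and its compatibility with
  \<open>\<Phi>\<^sup>*\<close> and \<sigma>\<close>

abbreviation y2_weight :: "complex \<Rightarrow> rvar \<Rightarrow> complex" where
  "y2_weight l \<equiv> (\<lambda>_. 1)(Ry2 := l)"

abbreviation rescale :: "complex \<Rightarrow> rvar mpoly \<Rightarrow> rvar mpoly" where
  "rescale l \<equiv> scale_vars (y2_weight l)"

text \<open>Both sides are substitutions, so comparing them at the variables is enough. Only
  \<open>Ry2\<close> carries \<open>l\<close>; the images of \<open>Rz1\<close> and
  \<open>Rz2\<close> use \<open>f\<close> and \<open>g\<close>, in which \<open>y\<^sub>2\<close>
  does not occur.\<close>

lemma phi_rescale: "phi \<alpha> 1 (rescale l p) = phi \<alpha> l p"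
proof -
  have "msubst (phi_var \<alpha> 1) (mconst (y2_weight l v) * mvar v) = phi_var \<alpha> l v" for v
    by (cases v) (simp_all add: poly_f_def poly_g_def algebra_simps)
  then show ?thesis by (simp add: phi_def scale_vars_def msubst_msubst)
qed

text \<open>Up to signs, \<sigma> fixes \<open>y\<^sub>2\<close> and permutes the other variables,
  all of which have weight 1.\<close>

lemma sigma_R_rescale: "sigma_R (rescale l p) = rescale l (sigma_R p)"
proof -
  have "msubst sigma_var (mconst (y2_weight l v) * mvar v) =
      msubst (\<lambda>v. mconst (y2_weight l v) * mvar v) (sigma_var v)" for v
    by (cases v) simp_all
  then show ?thesis by (simp add: sigma_R_def scale_vars_def msubst_msubst)
qed

lemma mvar_eq_iff [simp]: "mvar v = mvar w \<longleftrightarrow> v = w"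
proof
  assume "mvar v = mvar w"
  then have "keys (mvar v) = keys (mvar w)" by simp
  then have "keys (single v (1::nat)) = keys (single w (1::nat))"
    by (simp add: mvar_def)
  then show "v = w" by simp
qed simp

lemma mvar_neq_0 [simp]: "mvar v \<noteq> 0"
proof
  assume "mvar v = 0"
  then have "keys (mvar v) = {}" by simp
  then show False by (simp add: mvar_def)
qed

text \<open>Membership in the fraction field of the image of \<open>phi \<alpha> l\<close>, with the
  denominator cleared so that everything stays in the polynomial ring. On residues of this kind a
  residue map is determined up to one constant.\<close>

definition phi_fraction :: "complex \<Rightarrow> complex \<Rightarrow> pvar mpoly \<Rightarrow> bool" where
  "phi_fraction \<alpha> l w \<longleftrightarrow> (\<exists>p q. phi \<alpha> l p \<noteq> 0 \<and> phi \<alpha> l p * w = phi \<alpha> l q)"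

lemma phi_fraction_1: "phi_fraction \<alpha> l 1"
  unfolding phi_fraction_def by (intro exI[of _ 1]) (simp add: phi_def)

lemma phi_fraction_mult:
  assumes "phi_fraction \<alpha> l w" "phi_fraction \<alpha> l w'"
  shows "phi_fraction \<alpha> l (w * w')"
proof -
  from assms obtain p q p' q' where
    "phi \<alpha> l p \<noteq> 0" "phi \<alpha> l p * w = phi \<alpha> l q" "phi \<alpha> l p' \<noteq> 0" "phi \<alpha> l p' * w' = phi \<alpha> l q'"
    unfolding phi_fraction_def by blast
  then have "phi \<alpha> l (p * p') \<noteq> 0" "phi \<alpha> l (p * p') * (w * w') = phi \<alpha> l (q * q')"
    by (simp_all add: phi_def) (metis mult.assoc mult.left_commute)
  then show ?thesis unfolding phi_fraction_def by blast
qed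

text \<open>
  With \<open>d = \<Phi>\<^sup>*(y\<^sub>2)/l = x (u - v)\<close> one has \<open>x (\<Phi>\<^sup>*(y\<^sub>1 - y\<^sub>3) + 2 d) = d (u + v)\<close>; together
  with \<open>d = x (u - v)\<close> this expresses \<open>2 x d u\<close> and \<open>2 x d v\<close> in the image.
\<close>

lemma phi_fraction_u_v:
  assumes "l \<noteq> 0"
  shows "phi_fraction \<alpha> l (mvar Pu)" "phi_fraction \<alpha> l (mvar Pv)"
proof -
  let ?X = "mvar Px" and ?u = "mvar Pu" and ?v = "mvar Pv"
  define d where "d = mconst (inverse l) * mvar Ry2"
  define a where "a = mvar Rx * (mvar Ry1 - mvar Ry3 + 2 * d)"
  have "mconst (inverse l) * mconst l = 1"
    using assms by (simp flip: mconst_simps)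
  then have d: "phi \<alpha> l d = ?X * (?u - ?v)"
    by (simp add: d_def phi_def flip: mult.assoc)
  have a: "phi \<alpha> l a = ?X * ((?u\<^sup>2 + 2 * ?X * ?v) - (?v\<^sup>2 + 2 * ?X * ?u) + 2 * phi \<alpha> l d)"
    by (simp add: a_def phi_def)
  have xad: "phi \<alpha> l (mvar Rx * a + d\<^sup>2) = ?X * phi \<alpha> l a + (phi \<alpha> l d)\<^sup>2"
    "phi \<alpha> l (mvar Rx * a - d\<^sup>2) = ?X * phi \<alpha> l a - (phi \<alpha> l d)\<^sup>2"
    by (simp_all add: phi_def)
  have P: "phi \<alpha> l (2 * mvar Rx * d) = 2 * ?X * (?X * (?u - ?v))"
    using d by (simp add: phi_def)
  have nz: "phi \<alpha> l (2 * mvar Rx * d) \<noteq> 0"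
    unfolding P by simp
  have "phi \<alpha> l (2 * mvar Rx * d) * ?u = phi \<alpha> l (mvar Rx * a + d\<^sup>2)"
    unfolding P xad a d by (simp add: algebra_simps power2_eq_square)
  with nz show "phi_fraction \<alpha> l ?u" unfolding phi_fraction_def by blast
  have "phi \<alpha> l (2 * mvar Rx * d) * ?v = phi \<alpha> l (mvar Rx * a - d\<^sup>2)"
    unfolding P xad a d by (simp add: algebra_simps power2_eq_square)
  with nz show "phi_fraction \<alpha> l ?v" unfolding phi_fraction_def by blast
qed

section \<open>Rescaling and independence of the lifts\<close>

lemma scale_vars_sum: "scale_vars c (\<Sum>i\<in>A. f i) = (\<Sum>i\<in>A. scale_vars c (f i))"
  by (simp add: scale_vars_def msubst_sum)

lemma inj_rescale: "l \<noteq> 0 \<Longrightarrow> inj (rescale l)" and surj_rescale: "l \<noteq> 0 \<Longrightarrow> surj (rescale l)"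
  using bij_scale_vars[of "y2_weight l"] by (auto simp: bij_def)

lemma homogeneous_mconst_mult:
  "c \<noteq> 0 \<Longrightarrow> homogeneous wt d (mconst c * p) \<longleftrightarrow> homogeneous wt d p"
proof -
  assume "c \<noteq> 0"
  then have "keys (mconst c * p) = keys p"
    by (auto simp: in_keys_iff lookup_mconst_mult)
  then show ?thesis by (simp add: homogeneous_def)
qed

text \<open>The variable \<open>x\<close> has weight 1 and is fixed by the rescaling; for the
  converse, the cofactor is pulled back along the bijection.\<close>

lemma mvar_Rx_dvd_rescale:
  assumes "l \<noteq> 0"
  shows "mvar Rx dvd rescale l p \<longleftrightarrow> mvar Rx dvd p"
proof
  assume "mvar Rx dvd p"
  then obtain k where "p = mvar Rx * k" ..
  then have "rescale l p = mvar Rx * rescale l k" by simp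
  then show "mvar Rx dvd rescale l p" by simp
next
  assume "mvar Rx dvd rescale l p"
  then obtain k where "rescale l p = mvar Rx * k" ..
  moreover obtain k' where "k = rescale l k'"
    using surj_rescale[OF assms] by (metis surjD)
  ultimately have "rescale l p = rescale l (mvar Rx * k')" by simp
  then have "p = mvar Rx * k'" by (rule injD[OF inj_rescale[OF assms]])
  then show "mvar Rx dvd p" by simp
qed

text \<open>The degrees in \<open>y\<^sub>2\<close> of the residues modulo \<open>x\<close>.\<close>

definition generator_weight :: "nat \<Rightarrow> nat" where
  "generator_weight i = [0, 0, 2, 3, 2, 1] ! i"

section \<open>The six generators in degree 6 and the polynomials \<open>F\<close> and
  \<open>G\<close>\<close>

lemma rescale_residues6:
  assumes "i < 6"
  shows "rescale l (residues6 \<alpha> ! i) = mconst (l ^ generator_weight i) * residues6 \<alpha> ! i"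
proof -
  have "i = 0 \<or> i = 1 \<or> i = 2 \<or> i = 3 \<or> i = 4 \<or> i = 5" using assms by auto
  then show ?thesis
    by (elim disjE) (simp_all add: residues6_def generator_weight_def poly_f_def poly_g_def
        power_mult_distrib algebra_simps)
qed

lemma gamma_ideal6_rescale:
  assumes "l \<noteq> 0"
  shows "rescale l p \<in> gamma_ideal6 \<alpha> 1 \<longleftrightarrow> p \<in> gamma_ideal6 \<alpha> l"
proof -
  have "y2_weight l v \<noteq> 0" for v using assms by simp
  then show ?thesis
    by (simp add: gamma_ideal6_def gamma_ideal_def phi_rescale homogeneous_scale_vars)
qed

lemma gamma_ideal6_mconst_mult:
  assumes "c \<noteq> 0"
  shows "mconst c * p \<in> gamma_ideal6 \<alpha> l \<longleftrightarrow> p \<in> gamma_ideal6 \<alpha> l"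
  using assms by (simp add: gamma_ideal6_def gamma_ideal_def phi_def homogeneous_mconst_mult)

lemma mconst_mult_cancel: "a * b = 1 \<Longrightarrow> mconst a * (mconst b * p) = p"
  by (simp flip: mult.assoc mconst_simps(7))

lemma dvd_mconst_mult: "c \<noteq> 0 \<Longrightarrow> q dvd mconst c * p \<longleftrightarrow> q dvd p"
  by (metis dvd_mult mconst_mult_cancel left_inverse)

context
  fixes l :: complex
  assumes l: "l \<noteq> 0"
begin

text \<open>Rescaling multiplies the prescribed residue by \<open>l ^ generator_weight i\<close>, so
  a generator for \<open>l\<close> becomes that multiple of a generator for 1. Membership in the
  ideal and divisibility by \<open>x\<close> are insensitive to nonzero constants.\<close>

lemma is_generator6_rescale:
  assumes "i < 6"
  shows "is_generator6 \<alpha> 1 i q \<longleftrightarrow>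
    (\<exists>p. is_generator6 \<alpha> l i p \<and> rescale l p = mconst (l ^ generator_weight i) * q)"
proof -
  let ?c = "l ^ generator_weight i"
  have eq: "is_generator6 \<alpha> l i p \<longleftrightarrow> is_generator6 \<alpha> 1 i q"
    if "rescale l p = mconst ?c * q" for p
  proof -
    have "p \<in> gamma_ideal6 \<alpha> l \<longleftrightarrow> q \<in> gamma_ideal6 \<alpha> 1"
      using gamma_ideal6_rescale[OF l, of p \<alpha>] gamma_ideal6_mconst_mult[of ?c q \<alpha> 1] that l by simp
    moreover have "rescale l (p - residues6 \<alpha> ! i) = mconst ?c * (q - residues6 \<alpha> ! i)"
      using that rescale_residues6[OF assms] by (simp add: algebra_simps)
    then have "mvar Rx dvd p - residues6 \<alpha> ! i \<longleftrightarrow> mvar Rx dvd q - residues6 \<alpha> ! i"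
      using mvar_Rx_dvd_rescale[OF l] dvd_mconst_mult[of ?c] l by (metis power_not_zero)
    ultimately show ?thesis by (simp add: is_generator6_def)
  qed
  moreover obtain p where "rescale l p = mconst ?c * q"
    using surj_rescale[OF l] by (metis surjD)
  ultimately show ?thesis by blast
qed

text \<open>Uniqueness turns the correspondence between the defining conditions into an equation
  between the polynomials picked out by \<open>THE\<close>.\<close>

lemma generator6_rescale:
  assumes gen: "generators6_exist \<alpha> l"
  shows "i < 6 \<Longrightarrow> rescale l (generator6 \<alpha> l i) = mconst (l ^ generator_weight i) * generator6 \<alpha> 1 i"
    and "generators6_exist \<alpha> 1"
proof -
  have ex: "\<exists>!q. is_generator6 \<alpha> 1 i q" and
    r: "rescale l (generator6 \<alpha> l i) = mconst (l ^ generator_weight i) * generator6 \<alpha> 1 i" if "i < 6" for i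
  proof -
    let ?c = "l ^ generator_weight i"
    have c: "inverse ?c * ?c = 1" "?c * inverse ?c = 1" using l by simp_all
    have p: "is_generator6 \<alpha> l i p \<longleftrightarrow> p = generator6 \<alpha> l i" for p
      unfolding generator6_def using gen that generators6_exist_def by (metis the1_equality theI')
    have q: "is_generator6 \<alpha> 1 i q \<longleftrightarrow> q = mconst (inverse ?c) * rescale l (generator6 \<alpha> l i)" for q
      unfolding is_generator6_rescale[OF that] p
      using mconst_mult_cancel[OF c(1)] mconst_mult_cancel[OF c(2)] by metis
    then show "\<exists>!q. is_generator6 \<alpha> 1 i q" by simp
    have "generator6 \<alpha> 1 i = mconst (inverse ?c) * rescale l (generator6 \<alpha> l i)"
      unfolding generator6_def[of \<alpha> 1] q by simp
    then show "rescale l (generator6 \<alpha> l i) = mconst ?c * generator6 \<alpha> 1 i"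
      by (simp only: mconst_mult_cancel[OF c(2)])
  qed
  show "i < 6 \<Longrightarrow> rescale l (generator6 \<alpha> l i) = mconst (l ^ generator_weight i) * generator6 \<alpha> 1 i"
    by (rule r)
  have sum: "rescale l (\<Sum>i<6. mconst (c i) * generator6 \<alpha> l i) =
      (\<Sum>i<6. mconst (c i * l ^ generator_weight i) * generator6 \<alpha> 1 i)" for c
    unfolding scale_vars_sum by (rule sum.cong) (simp_all add: r mult.assoc)
  have "q \<in> gamma_ideal6 \<alpha> 1 \<longleftrightarrow> (\<exists>c. q = (\<Sum>i<6. mconst (c i) * generator6 \<alpha> 1 i))" for q
  proof -
    obtain p where p: "q = rescale l p" using surj_rescale[OF l] by (metis surjD)
    have "q \<in> gamma_ideal6 \<alpha> 1 \<longleftrightarrow> (\<exists>c. p = (\<Sum>i<6. mconst (c i) * generator6 \<alpha> l i))"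
      using gen gamma_ideal6_rescale[OF l] by (auto simp: p generators6_exist_def)
    also have "\<dots> \<longleftrightarrow> (\<exists>c. q = (\<Sum>i<6. mconst (c i * l ^ generator_weight i) * generator6 \<alpha> 1 i))"
      unfolding sum[symmetric] p using inj_rescale[OF l] by (simp add: inj_eq)
    \<comment> \<open>The powers of \<open>l\<close> are invertible, so they can be absorbed into
      the coefficients and the span is unchanged.\<close>
    also have "\<dots> \<longleftrightarrow> (\<exists>c. q = (\<Sum>i<6. mconst (c i) * generator6 \<alpha> 1 i))"
    proof safe
      fix c
      show "\<exists>c'. (\<Sum>i<6. mconst (c i * l ^ generator_weight i) * generator6 \<alpha> 1 i) =
          (\<Sum>i<6. mconst (c' i) * generator6 \<alpha> 1 i)"
        by (rule exI) (rule refl)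
    next
      fix c
      show "\<exists>c'. (\<Sum>i<6. mconst (c i) * generator6 \<alpha> 1 i) =
          (\<Sum>i<6. mconst (c' i * l ^ generator_weight i) * generator6 \<alpha> 1 i)"
        using l by (intro exI[of _ "\<lambda>i. c i / l ^ generator_weight i"]) (simp del: mconst_simps)
    qed
    finally show ?thesis .
  qed
  with ex show "generators6_exist \<alpha> 1"
    unfolding generators6_exist_def by blast
qed

text \<open>\<open>C\<^sub>1\<close> and \<open>C\<^sub>2\<close> have weight 0, so the powers of
  \<open>l\<close> only enter the parameters. \<open>Q\<^sub>1\<close> and \<open>Q\<^sub>3\<close>
  have equal weight, which makes the new values agree in \<open>F\<close> and \<open>G\<close>
  although \<open>l1\<close> and \<open>l3\<close> change places.\<close>

lemma rescale_poly_F_G: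
  assumes "generators6_exist \<alpha> l"
  shows "rescale l (poly_F \<alpha> l l1 l2 l3 l4) = poly_F \<alpha> 1 (l\<^sup>2 * l1) (l ^ 3 * l2) (l\<^sup>2 * l3) (l * l4)"
    and "rescale l (poly_G \<alpha> l l1 l2 l3 l4) = poly_G \<alpha> 1 (l\<^sup>2 * l1) (l ^ 3 * l2) (l\<^sup>2 * l3) (l * l4)"
  using generator6_rescale(1)[OF assms]
  by (simp_all add: poly_F_def poly_G_def generator_weight_def mult_ac)

end

text \<open>Applies to the residue of an element of degree 2, because residue maps lower degrees by
  2.\<close>

lemma homogeneous_pweight_0:
  assumes "homogeneous pweight 0 p"
  shows "\<exists>c. p = mconst c"
proof -
  have "m = 0" if "m \<in> keys p" for m
  proof (rule poly_mapping_eqI)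
    fix v
    have "\<forall>v\<in>keys m. lookup m v = 0"
      using assms that by (simp add: homogeneous_def)
    then show "lookup m v = lookup 0 v"
      by (auto simp: in_keys_iff)
  qed
  then have "p = mconst (lookup p 0)"
    by (intro poly_mapping_eqI) (auto simp: mconst_def lookup_single when_def in_keys_iff)
  then show ?thesis ..
qed

section \<open>The ring \<open>A\<close>, its fraction field and uniqueness of residue maps\<close>

lemma domain_ring_A:
  assumes "primeideal J ring_R"
  shows "domain (ring_A J)"
  unfolding ring_A_def using assms
  by (intro primeideal.quotient_is_domain)

context
  fixes J :: "rvar mpoly set"
  assumes J: "primeideal J ring_R"
begin

interpretation J: primeideal J ring_R by (rule J)
interpretation K: cring "field_K J"
  unfolding field_K_def by (rule frac_field_cring[OF domain_ring_A[OF J]])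
interpretation A: domain "ring_A J" by (rule domain_ring_A[OF J])

lemma coset_simps:
  "J +>\<^bsub>ring_R\<^esub> p \<in> carrier (ring_A J)"
  "J +>\<^bsub>ring_R\<^esub> (p + q) = (J +>\<^bsub>ring_R\<^esub> p) \<oplus>\<^bsub>ring_A J\<^esub> (J +>\<^bsub>ring_R\<^esub> q)"
  "J +>\<^bsub>ring_R\<^esub> (p * q) = (J +>\<^bsub>ring_R\<^esub> p) \<otimes>\<^bsub>ring_A J\<^esub> (J +>\<^bsub>ring_R\<^esub> q)"
  "J +>\<^bsub>ring_R\<^esub> 1 = \<one>\<^bsub>ring_A J\<^esub>"
  "J +>\<^bsub>ring_R\<^esub> 0 = \<zero>\<^bsub>ring_A J\<^esub>"
proof -
  have hom: "(+>\<^bsub>ring_R\<^esub>) J \<in> ring_hom ring_R (ring_A J)"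
    unfolding ring_A_def by (rule J.rcos_ring_hom)
  show "J +>\<^bsub>ring_R\<^esub> p \<in> carrier (ring_A J)"
    using ring_hom_closed[OF hom, of p] by (simp add: ring_of_type_algebra_def)
  show "J +>\<^bsub>ring_R\<^esub> (p + q) = (J +>\<^bsub>ring_R\<^esub> p) \<oplus>\<^bsub>ring_A J\<^esub> (J +>\<^bsub>ring_R\<^esub> q)"
    using ring_hom_add[OF hom, of p q] by (simp add: ring_of_type_algebra_def)
  show "J +>\<^bsub>ring_R\<^esub> (p * q) = (J +>\<^bsub>ring_R\<^esub> p) \<otimes>\<^bsub>ring_A J\<^esub> (J +>\<^bsub>ring_R\<^esub> q)"
    using ring_hom_mult[OF hom, of p q] by (simp add: ring_of_type_algebra_def)
  show "J +>\<^bsub>ring_R\<^esub> 1 = \<one>\<^bsub>ring_A J\<^esub>"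
    using ring_hom_one[OF hom] by (simp add: ring_of_type_algebra_def)
  from ring_hom_zero[OF hom J.ring_axioms A.ring_axioms]
  show "J +>\<^bsub>ring_R\<^esub> 0 = \<zero>\<^bsub>ring_A J\<^esub>" by (simp add: ring_of_type_algebra_def)
qed

lemma to_K_simps:
  "to_K J p \<in> carrier (field_K J)"
  "to_K J (p + q) = to_K J p \<oplus>\<^bsub>field_K J\<^esub> to_K J q"
  "to_K J (p * q) = to_K J p \<otimes>\<^bsub>field_K J\<^esub> to_K J q"
  "to_K J 1 = \<one>\<^bsub>field_K J\<^esub>"
  "to_K J 0 = \<zero>\<^bsub>field_K J\<^esub>"
proof -
  note frac = frac_class_closed frac_class_add frac_class_mult frac_field_one frac_field_zero
  note frac' = frac[OF domain_ring_A[OF J]]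
  show "to_K J p \<in> carrier (field_K J)"
    by (simp add: to_K_def field_K_def frac' coset_simps)
  show "to_K J (p + q) = to_K J p \<oplus>\<^bsub>field_K J\<^esub> to_K J q"
    by (simp add: to_K_def field_K_def frac' coset_simps)
  show "to_K J (p * q) = to_K J p \<otimes>\<^bsub>field_K J\<^esub> to_K J q"
    by (simp add: to_K_def field_K_def frac' coset_simps)
  show "to_K J 1 = \<one>\<^bsub>field_K J\<^esub>" "to_K J 0 = \<zero>\<^bsub>field_K J\<^esub>"
    by (simp_all add: to_K_def field_K_def frac' coset_simps)
qed

lemma hom_I_A_carrier: "q \<in> hom_I_A \<alpha> l J \<Longrightarrow> q \<in> carrier (field_K J)"
  by (simp add: hom_I_A_def)

lemma hom_I_A_add:
  assumes "q \<in> hom_I_A \<alpha> l J" "q' \<in> hom_I_A \<alpha> l J"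
  shows "q \<oplus>\<^bsub>field_K J\<^esub> q' \<in> hom_I_A \<alpha> l J"
proof -
  have "(q \<oplus>\<^bsub>field_K J\<^esub> q') \<otimes>\<^bsub>field_K J\<^esub> to_K J p \<in> range (to_K J)" if p: "p \<in> gamma_ideal \<alpha> l" for p
  proof -
    obtain r r' where "q \<otimes>\<^bsub>field_K J\<^esub> to_K J p = to_K J r" "q' \<otimes>\<^bsub>field_K J\<^esub> to_K J p = to_K J r'"
      using assms p by (fastforce simp: hom_I_A_def)
    then have "(q \<oplus>\<^bsub>field_K J\<^esub> q') \<otimes>\<^bsub>field_K J\<^esub> to_K J p = to_K J (r + r')"
      using assms[THEN hom_I_A_carrier] by (simp add: K.l_distr to_K_simps)
    then show ?thesis by simp
  qed
  then show ?thesis using assms by (simp add: hom_I_A_def)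
qed

lemma hom_I_A_smult:
  assumes "q \<in> hom_I_A \<alpha> l J"
  shows "to_K J s \<otimes>\<^bsub>field_K J\<^esub> q \<in> hom_I_A \<alpha> l J"
proof -
  have "(to_K J s \<otimes>\<^bsub>field_K J\<^esub> q) \<otimes>\<^bsub>field_K J\<^esub> to_K J p \<in> range (to_K J)" if p: "p \<in> gamma_ideal \<alpha> l" for p
  proof -
    obtain r where "q \<otimes>\<^bsub>field_K J\<^esub> to_K J p = to_K J r"
      using assms p by (fastforce simp: hom_I_A_def)
    then have "(to_K J s \<otimes>\<^bsub>field_K J\<^esub> q) \<otimes>\<^bsub>field_K J\<^esub> to_K J p = to_K J (s * r)"
      using hom_I_A_carrier[OF assms] by (simp add: K.m_assoc to_K_simps)
    then show ?thesis by simp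
  qed
  then show ?thesis using hom_I_A_carrier[OF assms] by (simp add: hom_I_A_def to_K_simps)
qed

context
  fixes \<alpha> l :: complex and \<rho> \<rho>' :: "frac_elt \<Rightarrow> pvar mpoly" and y4 :: frac_elt
  assumes \<rho>: "residue_map \<alpha> l J \<rho>" and \<rho>': "residue_map \<alpha> l J \<rho>'"
    and y4: "y4 \<in> hom_I_A \<alpha> l J \<inter> K_degree J 2" "\<rho> y4 = 1"
begin

lemma residue_map_comb:
  assumes "residue_map \<alpha> l J \<rho>''" "q \<in> hom_I_A \<alpha> l J" "q' \<in> hom_I_A \<alpha> l J"
  shows "\<rho>'' (to_K J p \<otimes>\<^bsub>field_K J\<^esub> q \<oplus>\<^bsub>field_K J\<^esub> to_K J p' \<otimes>\<^bsub>field_K J\<^esub> q') =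
    phi \<alpha> l p * \<rho>'' q + phi \<alpha> l p' * \<rho>'' q'"
  using assms hom_I_A_smult by (simp add: residue_map_def)

lemma residue_map_ker:
  assumes "residue_map \<alpha> l J \<rho>''" "q \<in> hom_I_A \<alpha> l J"
  shows "\<rho>'' q = 0 \<longleftrightarrow> q \<in> range (to_K J)"
  using assms unfolding residue_map_def by blast

text \<open>If \<open>phi \<alpha> l p * \<rho> q = phi \<alpha> l p'\<close>, then
  \<open>p q - p' y4\<close> lies in the kernel of \<rho>. Both residue maps have the image of
  \<open>A\<close> as kernel, so \<rho>' kills this element too. Cancelling
  \<open>phi \<alpha> l p\<close> gives the claim, with \<open>c\<close> the value of \<rho>' at
  \<open>y4\<close>.\<close>

lemma residue_map_unique:
  obtains c where "c \<noteq> 0"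
    "\<And>q. q \<in> hom_I_A \<alpha> l J \<Longrightarrow> phi_fraction \<alpha> l (\<rho> q) \<Longrightarrow> \<rho>' q = mconst c * \<rho> q"
proof -
  have "homogeneous pweight 0 (\<rho>' y4)"
  proof -
    have "\<forall>d. \<forall>q\<in>hom_I_A \<alpha> l J \<inter> K_degree J d.
        if d < 2 then \<rho>' q = 0 else homogeneous pweight (d - 2) (\<rho>' q)"
      using \<rho>' unfolding residue_map_def by (elim conjE)
    from this[rule_format, OF y4(1)] show ?thesis by simp
  qed
  then obtain c where c: "\<rho>' y4 = mconst c"
    using homogeneous_pweight_0 by blast
  \<comment> \<open>Otherwise \<open>y4\<close> would be in the common kernel, contradicting
    \<open>\<rho> y4 = 1\<close>.\<close>
  have "c \<noteq> 0"
  proof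
    assume "c = 0"
    then have "\<rho>' y4 = 0" using c by simp
    then have "\<rho> y4 = 0" using residue_map_ker \<rho> \<rho>' y4(1) by blast
    then show False using y4(2) by simp
  qed
  moreover have "\<rho>' q = mconst c * \<rho> q" if q: "q \<in> hom_I_A \<alpha> l J" and fr: "phi_fraction \<alpha> l (\<rho> q)" for q
  proof -
    obtain p p' where p: "phi \<alpha> l p \<noteq> 0" "phi \<alpha> l p * \<rho> q = phi \<alpha> l p'"
      using fr unfolding phi_fraction_def by blast
    let ?r = "to_K J p \<otimes>\<^bsub>field_K J\<^esub> q \<oplus>\<^bsub>field_K J\<^esub> to_K J (- p') \<otimes>\<^bsub>field_K J\<^esub> y4"
    have y4h: "y4 \<in> hom_I_A \<alpha> l J" using y4(1) by simp
    have r: "?r \<in> hom_I_A \<alpha> l J" using q y4h by (intro hom_I_A_add hom_I_A_smult)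
    have neg: "phi \<alpha> l (- p') = - phi \<alpha> l p'" by (simp add: phi_def)
    have "\<rho> ?r = 0" unfolding residue_map_comb[OF \<rho> q y4h] using p y4(2) neg by simp
    then have "\<rho>' ?r = 0" using residue_map_ker[OF \<rho> r] residue_map_ker[OF \<rho>' r] by simp
    then have "phi \<alpha> l p * \<rho>' q = phi \<alpha> l p' * mconst c"
      unfolding residue_map_comb[OF \<rho>' q y4h] using neg c by simp
    also have "\<dots> = phi \<alpha> l p * (mconst c * \<rho> q)" unfolding p(2)[symmetric] by (simp add: mult_ac)
    finally show ?thesis using p(1) by simp
  qed
  ultimately show thesis using that by blast
qed

text \<open>The map \<rho>' takes the same value on \<open>s\<close> and on a constant multiple of
  \<open>s'\<close>, so the two differ by an element of \<open>A\<close>, which lies in every ring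
  generated by such an \<open>H\<close>.\<close>

lemma lift_in_generate_ring:
  assumes s: "s \<in> hom_I_A \<alpha> l J" "phi_fraction \<alpha> l (\<rho> s)"
    and s': "s' \<in> hom_I_A \<alpha> l J" "\<rho>' s' = \<rho> s" "s' \<in> H" and H: "range (to_K J) \<subseteq> H"
  shows "s \<in> generate_ring (field_K J) H"
proof -
  obtain c where c: "\<rho>' s = mconst c * \<rho> s"
    using residue_map_unique s by metis
  \<comment> \<open>The coefficient 1 only brings the difference into the shape required by
    \<open>residue_map_comb\<close>.\<close>
  let ?r = "to_K J 1 \<otimes>\<^bsub>field_K J\<^esub> s \<oplus>\<^bsub>field_K J\<^esub> to_K J (mconst (- c)) \<otimes>\<^bsub>field_K J\<^esub> s'"
  have r: "?r \<in> hom_I_A \<alpha> l J" using s s' by (intro hom_I_A_add hom_I_A_smult)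
  have "\<rho>' ?r = 0" unfolding residue_map_comb[OF \<rho>' s(1) s'(1)] using c s'(2) by (simp add: phi_def)
  then obtain p where p: "?r = to_K J p" using residue_map_ker[OF \<rho>' r] by auto
  have car: "s \<in> carrier (field_K J)" "s' \<in> carrier (field_K J)"
    using s s' hom_I_A_carrier by auto
  have "to_K J (mconst (- c)) \<oplus>\<^bsub>field_K J\<^esub> to_K J (mconst c) = \<zero>\<^bsub>field_K J\<^esub>"
    by (simp flip: to_K_simps)
  then have z: "to_K J (mconst (- c)) \<otimes>\<^bsub>field_K J\<^esub> s'
      \<oplus>\<^bsub>field_K J\<^esub> to_K J (mconst c) \<otimes>\<^bsub>field_K J\<^esub> s' = \<zero>\<^bsub>field_K J\<^esub>"
    using car to_K_simps(1) by (metis K.l_distr K.l_null)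
  have "s = ?r \<oplus>\<^bsub>field_K J\<^esub> to_K J (mconst c) \<otimes>\<^bsub>field_K J\<^esub> s'"
    using car z to_K_simps(1) by (simp add: K.a_assoc to_K_simps(4) del: mconst_simps)
  then have "s = to_K J p \<oplus>\<^bsub>field_K J\<^esub> to_K J (mconst c) \<otimes>\<^bsub>field_K J\<^esub> s'" unfolding p .
  moreover have "to_K J q \<in> generate_ring (field_K J) H" for q
    using H by (auto intro: generate_ring.incl)
  moreover have "s' \<in> generate_ring (field_K J) H" using s'(3) by (rule generate_ring.incl)
  ultimately show ?thesis by (metis generate_ring.eng_add generate_ring.eng_mult)
qed

end

text \<open>The two tuples may be lifts for different residue maps. Since 1, \<open>u\<close>,
  \<open>v\<close> and \<open>uv\<close> all lie in the fraction field of the image,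
  \<open>lift_in_generate_ring\<close> applies to each generator; the reverse inclusion is the same
  lemma with the tuples exchanged.\<close>

lemma unprojection_lifts_subset:
  assumes "l \<noteq> 0" "unprojection_lifts \<alpha> l J (y4, z3, z4, t)" "unprojection_lifts \<alpha> l J (y4', z3', z4', t')"
  shows "generate_ring (field_K J) (range (to_K J) \<union> {y4, z3, z4, t})
    \<subseteq> generate_ring (field_K J) (range (to_K J) \<union> {y4', z3', z4', t'})"
proof -
  let ?H = "range (to_K J) \<union> {y4, z3, z4, t}" and ?H' = "range (to_K J) \<union> {y4', z3', z4', t'}"
  obtain \<rho> where \<rho>: "residue_map \<alpha> l J \<rho>" and
    lifts: "y4 \<in> hom_I_A \<alpha> l J \<inter> K_degree J 2" "\<rho> y4 = 1"
      "z3 \<in> hom_I_A \<alpha> l J" "\<rho> z3 = mvar Pu" "z4 \<in> hom_I_A \<alpha> l J" "\<rho> z4 = mvar Pv"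
      "t \<in> hom_I_A \<alpha> l J" "\<rho> t = mvar Pu * mvar Pv"
    using assms(2) unfolding unprojection_lifts_def by auto
  obtain \<rho>' where \<rho>': "residue_map \<alpha> l J \<rho>'" and
    lifts': "y4' \<in> hom_I_A \<alpha> l J" "\<rho>' y4' = 1"
      "z3' \<in> hom_I_A \<alpha> l J" "\<rho>' z3' = mvar Pu" "z4' \<in> hom_I_A \<alpha> l J" "\<rho>' z4' = mvar Pv"
      "t' \<in> hom_I_A \<alpha> l J" "\<rho>' t' = mvar Pu * mvar Pv"
    using assms(3) unfolding unprojection_lifts_def by auto
  note fr = phi_fraction_1[of \<alpha> l] phi_fraction_u_v[OF assms(1), of \<alpha>]
    phi_fraction_mult[OF phi_fraction_u_v[OF assms(1), of \<alpha>]]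
  note in_gen = lift_in_generate_ring[OF \<rho> \<rho>' lifts(1,2), of _ _ ?H']
  have "y4 \<in> generate_ring (field_K J) ?H'" by (rule in_gen[of _ y4']) (use lifts lifts' fr in auto)
  moreover have "z3 \<in> generate_ring (field_K J) ?H'" by (rule in_gen[of _ z3']) (use lifts lifts' fr in auto)
  moreover have "z4 \<in> generate_ring (field_K J) ?H'" by (rule in_gen[of _ z4']) (use lifts lifts' fr in auto)
  moreover have "t \<in> generate_ring (field_K J) ?H'" by (rule in_gen[of _ t']) (use lifts lifts' fr in auto)
  ultimately have sub: "?H \<subseteq> generate_ring (field_K J) ?H'"
    by (auto intro: generate_ring.incl)
  have "?H \<subseteq> carrier (field_K J)" "?H' \<subseteq> carrier (field_K J)"
    using lifts lifts' to_K_simps(1) hom_I_A_carrier by auto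
  with sub show ?thesis
    by (meson K.generate_ring_is_subring K.generate_ring_min_subring1)
qed

text \<open>Eliminates the choice operator from the definition, so that lifts obtained by transport
  may be used to compute the ring.\<close>

lemma unprojection_ring_eq:
  assumes "l \<noteq> 0" "unprojection_lifts \<alpha> l J (y4, z3, z4, t)"
  shows "unprojection_ring \<alpha> l J =
    field_K J \<lparr>carrier := generate_ring (field_K J) (range (to_K J) \<union> {y4, z3, z4, t})\<rparr>"
proof -
  obtain y4' z3' z4' t' where some: "(SOME ys. unprojection_lifts \<alpha> l J ys) = (y4', z3', z4', t')"
    by (metis prod_cases4)
  then have "unprojection_lifts \<alpha> l J (y4', z3', z4', t')"
    using someI[of "unprojection_lifts \<alpha> l J", OF assms(2)] by simp
  then have "generate_ring (field_K J) (range (to_K J) \<union> {y4', z3', z4', t'}) =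
      generate_ring (field_K J) (range (to_K J) \<union> {y4, z3, z4, t})"
    using unprojection_lifts_subset assms by blast
  then show ?thesis by (simp add: unprojection_ring_def some)
qed

lemma unprojection_lifts_carrier:
  assumes "unprojection_lifts \<alpha> l J (y4, z3, z4, t)"
  shows "range (to_K J) \<union> {y4, z3, z4, t} \<subseteq> carrier (field_K J)"
  using assms to_K_simps(1) hom_I_A_carrier unfolding unprojection_lifts_def by auto

lemma field_K_cring: "cring (field_K J)" by (rule K.cring_axioms)

end

section \<open>Transport of the construction\<close>

text \<open>
  Relates only the parameter values \<open>a\<close> and \<open>b\<close>. With it the construction for \<open>l\<close> can be related to the
  one for \<open>1\<close>, although both are values of the same function, which is not parametric in \<open>l\<close>.
\<close>

definition only :: "'a \<Rightarrow> 'b \<Rightarrow> 'a \<Rightarrow> 'b \<Rightarrow> bool" where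
  "only a b x y \<longleftrightarrow> x = a \<and> y = b"

lemma only_self: "only a b a b"
  by (simp add: only_def)

definition rescale_rel :: "complex \<Rightarrow> rvar mpoly \<Rightarrow> rvar mpoly \<Rightarrow> bool" where
  "rescale_rel l p q \<longleftrightarrow> q = rescale l p"

text \<open>Follows the encoding: an element of the fraction field is a set of pairs of cosets, and
  a coset is a set of polynomials.\<close>

abbreviation frac_rel :: "complex \<Rightarrow> frac_elt \<Rightarrow> frac_elt \<Rightarrow> bool" where
  "frac_rel l \<equiv> rel_set (rel_prod (rel_set (rescale_rel l)) (rel_set (rescale_rel l)))"

abbreviation point_rel ::
  "complex \<Rightarrow> (frac_elt \<Rightarrow> complex) set \<Rightarrow> (frac_elt \<Rightarrow> complex) set \<Rightarrow> bool" where
  "point_rel l \<equiv> rel_set (rel_fun (frac_rel l) (=))"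

text \<open>Unlike in \<open>coughlan_Y\<close>, the ideal is an argument, so that two related
  ideals can be inserted.\<close>

definition surface_Y ::
  "complex \<Rightarrow> complex \<Rightarrow> rvar mpoly set \<Rightarrow> frac_elt set \<Rightarrow> (frac_elt \<Rightarrow> complex) set variety" where
  "surface_Y \<alpha> l J H = (let W = variety_W \<alpha> l J
     in closed_subvariety W {P \<in> topspace (vtop W). \<forall>\<chi>\<in>P. \<forall>h\<in>H. \<chi> h = 0})"

text \<open>Again the negative is replaced by an equation that involves only ring operations and is
  therefore parametric.\<close>

lemma anti_invariants2_eq:
  assumes "cring (field_K J)"
  shows "anti_invariants2 \<alpha> l J = {h \<in> unprojection_degree \<alpha> l J 2.
    sigma_K h \<in> carrier (field_K J) \<and> sigma_K h \<oplus>\<^bsub>field_K J\<^esub> h = \<zero>\<^bsub>field_K J\<^esub>}"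
proof -
  interpret cring "field_K J" by fact
  have "sigma_K h = \<ominus>\<^bsub>field_K J\<^esub> h \<longleftrightarrow>
      sigma_K h \<in> carrier (field_K J) \<and> sigma_K h \<oplus>\<^bsub>field_K J\<^esub> h = \<zero>\<^bsub>field_K J\<^esub>"
    if "h \<in> unprojection_degree \<alpha> l J 2" for h
  proof -
    have "h \<in> carrier (field_K J)"
      using that by (simp add: unprojection_degree_def K_degree_def)
    then show ?thesis by (metis a_inv_closed l_neg minus_equality)
  qed
  then show ?thesis unfolding anti_invariants2_def by blast
qed

context
  includes lifting_syntax
begin

lemma Proj_transfer [transfer_rule]:
  assumes [transfer_rule]: "bi_unique A" "bi_total A"
  shows "(rel_ring A ===> ((=) ===> A) ===> ((=) ===> rel_set A) ===> rel_variety (rel_set (A ===> (=))))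
    Proj Proj"
  unfolding Proj_def generated_topology_def[symmetric] by transfer_prover

section \<open>Transfer rules along the rescaling\<close>

context
  fixes l :: complex
  assumes l: "l \<noteq> 0"
begin

lemma y2_weight_nonzero: "y2_weight l v \<noteq> 0"
  using l by simp

lemma bi_unique_rescale_rel [transfer_rule]: "bi_unique (rescale_rel l)"
  using inj_rescale[OF l] by (auto simp: bi_unique_def rescale_rel_def dest: injD)

lemma bi_total_rescale_rel [transfer_rule]: "bi_total (rescale_rel l)"
  using surj_rescale[OF l] by (auto simp: bi_total_def rescale_rel_def surj_def)

lemma ring_R_transfer [transfer_rule]: "rel_ring (rescale_rel l) ring_R ring_R"
  using surj_rescale[OF l]
  by (auto simp: rel_ring_def ring_of_type_algebra_def rescale_rel_def rel_fun_def rel_set_def surj_def)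

text \<open>The one place where the value \<open>l\<close> of the parameter is exchanged for 1; the
  rules that follow inherit the exchange through \<open>phi\<close>.\<close>

lemma phi_transfer [transfer_rule]:
  "(only \<alpha> \<alpha> ===> only l 1 ===> rescale_rel l ===> (=)) phi phi"
  by (simp add: rel_fun_def only_def rescale_rel_def phi_rescale)

lemma mconst_transfer [transfer_rule]: "((=) ===> rescale_rel l) mconst mconst"
  by (simp add: rel_fun_def rescale_rel_def)

lemma homogeneous_transfer [transfer_rule]:
  "((=) ===> (=) ===> rescale_rel l ===> (=)) homogeneous homogeneous"
  using homogeneous_scale_vars[of "y2_weight l", OF y2_weight_nonzero]
  by (simp add: rel_fun_def rescale_rel_def)

lemma sigma_R_transfer [transfer_rule]: "(rescale_rel l ===> rescale_rel l) sigma_R sigma_R"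
  by (simp add: rel_fun_def rescale_rel_def sigma_R_rescale)

lemma zero_poly_transfer [transfer_rule]: "rescale_rel l 0 0"
  by (simp add: rescale_rel_def)

lemma gamma_ideal_transfer [transfer_rule]:
  "(only \<alpha> \<alpha> ===> only l 1 ===> rel_set (rescale_rel l)) gamma_ideal gamma_ideal"
  unfolding gamma_ideal_def by transfer_prover

lemma ring_A_transfer [transfer_rule]:
  "(rel_set (rescale_rel l) ===> rel_ring (rel_set (rescale_rel l))) ring_A ring_A"
  unfolding ring_A_def by transfer_prover

lemma field_K_transfer [transfer_rule]:
  "(rel_set (rescale_rel l) ===> rel_ring (frac_rel l)) field_K field_K"
  unfolding field_K_def by transfer_prover

lemma to_K_transfer [transfer_rule]:
  "(rel_set (rescale_rel l) ===> rescale_rel l ===> frac_rel l) to_K to_K"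
  unfolding to_K_def by transfer_prover

lemma K_degree_transfer [transfer_rule]:
  "(rel_set (rescale_rel l) ===> (=) ===> rel_set (frac_rel l)) K_degree K_degree"
  unfolding K_degree_def by transfer_prover

lemma hom_I_A_transfer [transfer_rule]:
  "(only \<alpha> \<alpha> ===> only l 1 ===> rel_set (rescale_rel l) ===> rel_set (frac_rel l)) hom_I_A hom_I_A"
  unfolding hom_I_A_def by transfer_prover

lemma residue_map_transfer [transfer_rule]:
  "(only \<alpha> \<alpha> ===> only l 1 ===> rel_set (rescale_rel l) ===> (frac_rel l ===> (=)) ===> (=))
     residue_map residue_map"
  unfolding residue_map_def by transfer_prover

lemma unprojection_lifts_transfer [transfer_rule]:
  "(only \<alpha> \<alpha> ===> only l 1 ===> rel_set (rescale_rel l) ===>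
     rel_prod (frac_rel l) (rel_prod (frac_rel l) (rel_prod (frac_rel l) (frac_rel l))) ===> (=))
     unprojection_lifts unprojection_lifts"
  unfolding unprojection_lifts_def by transfer_prover

lemma sigma_K_transfer [transfer_rule]: "(frac_rel l ===> frac_rel l) sigma_K sigma_K"
  unfolding sigma_K_def by transfer_prover

section \<open>Constructions over a fixed pair of related ideals\<close>

context
  fixes \<alpha> :: complex and J J' :: "rvar mpoly set"
  assumes J_rel: "rel_set (rescale_rel l) J J'"
    and J: "primeideal J ring_R"
    and lifts: "\<exists>ys. unprojection_lifts \<alpha> l J ys"
begin

lemma rescaled_ideal_prime: "primeideal J' ring_R"
  using primeideal_transfer[OF bi_unique_rescale_rel bi_total_rescale_rel] J_rel ring_R_transfer J
  unfolding rel_fun_def by blast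

lemma rescaled_lifts_exist: "\<exists>ys. unprojection_lifts \<alpha> 1 J' ys"
proof -
  note [transfer_rule] = J_rel
  have "((only \<alpha> \<alpha> ===> only l 1 ===> (=)))
     (\<lambda>\<alpha> l. \<exists>ys. unprojection_lifts \<alpha> l J ys) (\<lambda>\<alpha> l. \<exists>ys. unprojection_lifts \<alpha> l J' ys)"
    by transfer_prover
  with lifts show ?thesis by (simp add: rel_fun_def only_def)
qed

text \<open>The unprojection ring is transported only for this pair of ideals, for which primality
  and lifts are known. Rules valid for all related ideals are restricted to the pair so that they
  combine with it.\<close>

lemma only_J_transfer:
  assumes "rel_fun (rel_set (rescale_rel l)) Q g h"
  shows "rel_fun (only J J') Q g h"
  using assms J_rel by (auto simp: rel_fun_def only_def)

lemmas field_K_only [transfer_rule] = only_J_transfer[OF field_K_transfer]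
lemmas to_K_only [transfer_rule] = only_J_transfer[OF to_K_transfer]
lemmas K_degree_only [transfer_rule] = only_J_transfer[OF K_degree_transfer]

text \<open>Lifts over \<open>J\<close> have partners over \<open>J'\<close>, and these are lifts
  again because the defining condition is parametric. By independence of the lifts, the chosen rings
  on both sides are the ones generated by these related tuples.\<close>

lemma unprojection_ring_transfer [transfer_rule]:
  "(only \<alpha> \<alpha> ===> only l 1 ===> only J J' ===> rel_ring (frac_rel l)) unprojection_ring unprojection_ring"
proof -
  obtain y4 z3 z4 t where ys: "unprojection_lifts \<alpha> l J (y4, z3, z4, t)"
    using lifts by (metis prod_cases4)
  have "bi_total (frac_rel l)" by (intro bi_total_rel_set prod.bi_total_rel bi_total_rescale_rel)
  then obtain y4' z3' z4' t' where [transfer_rule]: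
    "frac_rel l y4 y4'" "frac_rel l z3 z3'" "frac_rel l z4 z4'" "frac_rel l t t'"
    unfolding bi_total_def by metis
  note [transfer_rule] = J_rel
  \<comment> \<open>Abstracting over \<alpha> and \<open>l\<close> makes them bound variables
    related by \<open>only\<close>, so the rules for \<open>phi\<close> and its descendants
    apply.\<close>
  have "(only \<alpha> \<alpha> ===> only l 1 ===> (=))
     (\<lambda>\<alpha> l. unprojection_lifts \<alpha> l J (y4, z3, z4, t)) (\<lambda>\<alpha> l. unprojection_lifts \<alpha> l J' (y4', z3', z4', t'))"
    by transfer_prover
  then have ys': "unprojection_lifts \<alpha> 1 J' (y4', z3', z4', t')"
    using ys by (simp add: rel_fun_def only_def)
  have "bi_unique (frac_rel l)"
    by (intro bi_unique_rel_set prod.bi_unique_rel bi_unique_rescale_rel)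
  moreover have "rel_ring (frac_rel l) (field_K J) (field_K J')"
    by transfer_prover
  moreover have "rel_set (frac_rel l) (range (to_K J) \<union> {y4, z3, z4, t})
      (range (to_K J') \<union> {y4', z3', z4', t'})"
    by transfer_prover
  ultimately have [transfer_rule]: "rel_set (frac_rel l)
      (generate_ring (field_K J) (range (to_K J) \<union> {y4, z3, z4, t}))
      (generate_ring (field_K J') (range (to_K J') \<union> {y4', z3', z4', t'}))"
    using \<open>bi_total (frac_rel l)\<close> field_K_cring[OF J] unprojection_lifts_carrier[OF J ys]
    by (intro generate_ring_transfer) (auto simp: cring_def)
  \<comment> \<open>Opaque names make the two generated sets count as related atoms;
    \<open>generate_ring\<close> itself is transported only under hypotheses.\<close>
  define G where "G = generate_ring (field_K J) (range (to_K J) \<union> {y4, z3, z4, t})"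
  define G' where "G' = generate_ring (field_K J') (range (to_K J') \<union> {y4', z3', z4', t'})"
  have [transfer_rule]: "rel_set (frac_rel l) G G'"
    unfolding G_def G'_def by fact
  have "rel_ring (frac_rel l) (field_K J \<lparr>carrier := G\<rparr>) (field_K J' \<lparr>carrier := G'\<rparr>)"
    by transfer_prover
  then show ?thesis
    using unprojection_ring_eq[OF J l ys] unprojection_ring_eq[OF rescaled_ideal_prime one_neq_zero ys']
    unfolding G_def G'_def by (simp add: rel_fun_def only_def)
qed

lemma unprojection_degree_transfer [transfer_rule]:
  "(only \<alpha> \<alpha> ===> only l 1 ===> only J J' ===> (=) ===> rel_set (frac_rel l))
     unprojection_degree unprojection_degree"
  unfolding unprojection_degree_def by transfer_prover

lemma variety_W_transfer [transfer_rule]: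
  "(only \<alpha> \<alpha> ===> only l 1 ===> only J J' ===> rel_variety (point_rel l)) variety_W variety_W"
  unfolding variety_W_def by transfer_prover

lemma sigma_W_transfer [transfer_rule]:
  "(only \<alpha> \<alpha> ===> only l 1 ===> only J J' ===> point_rel l ===> point_rel l) sigma_W sigma_W"
  unfolding sigma_W_def restrict_def by transfer_prover

lemma anti_invariants2_transfer [transfer_rule]:
  "(only \<alpha> \<alpha> ===> only l 1 ===> only J J' ===> rel_set (frac_rel l)) anti_invariants2 anti_invariants2"
proof -
  have "(only \<alpha> \<alpha> ===> only l 1 ===> only J J' ===> rel_set (frac_rel l))
    (\<lambda>\<alpha> l J. {h \<in> unprojection_degree \<alpha> l J 2.
      sigma_K h \<in> carrier (field_K J) \<and> sigma_K h \<oplus>\<^bsub>field_K J\<^esub> h = \<zero>\<^bsub>field_K J\<^esub>})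
    (\<lambda>\<alpha> l J. {h \<in> unprojection_degree \<alpha> l J 2.
      sigma_K h \<in> carrier (field_K J) \<and> sigma_K h \<oplus>\<^bsub>field_K J\<^esub> h = \<zero>\<^bsub>field_K J\<^esub>})"
    by transfer_prover
  then show ?thesis
    using anti_invariants2_eq[OF field_K_cring[OF J]]
      anti_invariants2_eq[OF field_K_cring[OF rescaled_ideal_prime]]
    by (simp add: rel_fun_def only_def)
qed

lemma anti_invariants2_dim3_transfer:
  "(only \<alpha> \<alpha> ===> only l 1 ===> only J J' ===> (=)) anti_invariants2_dim3 anti_invariants2_dim3"
  unfolding anti_invariants2_dim3_def by transfer_prover

lemma plane_of_anti_invariants_transfer:
  "(only \<alpha> \<alpha> ===> only l 1 ===> only J J' ===> rel_set (rel_set (frac_rel l)))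
     plane_of_anti_invariants plane_of_anti_invariants"
  unfolding plane_of_anti_invariants_def by transfer_prover

lemma surface_Y_transfer [transfer_rule]:
  "(only \<alpha> \<alpha> ===> only l 1 ===> only J J' ===> rel_set (frac_rel l) ===> rel_variety (point_rel l))
     surface_Y surface_Y"
  unfolding surface_Y_def by transfer_prover

lemma member_conditions_transfer:
  "(only \<alpha> \<alpha> ===> only l 1 ===> only J J' ===> rel_set (frac_rel l) ===> (=))
    (\<lambda>\<alpha> l J H. primeideal (Idl\<^bsub>unprojection_ring \<alpha> l J\<^esub> H) (unprojection_ring \<alpha> l J) \<and>
      canonical_model_general_type (surface_Y \<alpha> l J H) \<and>
      has_geometric_genus (surface_Y \<alpha> l J H) 1 \<and> irregularity_zero (surface_Y \<alpha> l J H) \<and>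
      has_canonical_degree (surface_Y \<alpha> l J H) 2 \<and>
      (\<forall>P\<in>topspace (vtop (surface_Y \<alpha> l J H)). sigma_W \<alpha> l J P \<noteq> P))
    (\<lambda>\<alpha> l J H. primeideal (Idl\<^bsub>unprojection_ring \<alpha> l J\<^esub> H) (unprojection_ring \<alpha> l J) \<and>
      canonical_model_general_type (surface_Y \<alpha> l J H) \<and>
      has_geometric_genus (surface_Y \<alpha> l J H) 1 \<and> irregularity_zero (surface_Y \<alpha> l J H) \<and>
      has_canonical_degree (surface_Y \<alpha> l J H) 2 \<and>
      (\<forall>P\<in>topspace (vtop (surface_Y \<alpha> l J H)). sigma_W \<alpha> l J P \<noteq> P))"
  by transfer_prover

lemma surface_X_transfer:
  "(only \<alpha> \<alpha> ===> only l 1 ===> only J J' ===> rel_set (frac_rel l) ===> rel_variety (rel_set (point_rel l)))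
    (\<lambda>\<alpha> l J H. quotient_variety (surface_Y \<alpha> l J H) (sigma_W \<alpha> l J))
    (\<lambda>\<alpha> l J H. quotient_variety (surface_Y \<alpha> l J H) (sigma_W \<alpha> l J))"
  by transfer_prover

end

end

end

section \<open>The ideal \<open>(F, G)\<close> under rescaling, and reduction to
  \<open>l = 1\<close>\<close>

lemma ideal_FG_rescale:
  assumes "l \<noteq> 0" "generators6_exist \<alpha> l"
  shows "rel_set (rescale_rel l) (ideal_FG \<alpha> l l1 l2 l3 l4)
    (ideal_FG \<alpha> 1 (l\<^sup>2 * l1) (l ^ 3 * l2) (l\<^sup>2 * l3) (l * l4))"
proof -
  note [transfer_rule] = bi_unique_rescale_rel[OF assms(1)] bi_total_rescale_rel[OF assms(1)]
    ring_R_transfer[OF assms(1)]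
  \<comment> \<open>The generators are named because they correspond by
    \<open>rescale_poly_F_G\<close> as whole polynomials, with different parameters on the two
    sides.\<close>
  define F G where "F = poly_F \<alpha> l l1 l2 l3 l4" and "G = poly_G \<alpha> l l1 l2 l3 l4"
  define F' G' where "F' = poly_F \<alpha> 1 (l\<^sup>2 * l1) (l ^ 3 * l2) (l\<^sup>2 * l3) (l * l4)"
    and "G' = poly_G \<alpha> 1 (l\<^sup>2 * l1) (l ^ 3 * l2) (l\<^sup>2 * l3) (l * l4)"
  have [transfer_rule]: "rescale_rel l F F'" "rescale_rel l G G'"
    using rescale_poly_F_G[OF assms] by (simp_all add: rescale_rel_def F_def G_def F'_def G'_def)
  have "rel_set (rescale_rel l) (Idl\<^bsub>ring_R\<^esub> {F, G}) (Idl\<^bsub>ring_R\<^esub> {F', G'})"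
    by transfer_prover
  then show ?thesis
    by (simp add: ideal_FG_def F_def G_def F'_def G'_def)
qed

theorem proposition3p5:
  fixes \<alpha> l l1 l2 l3 l4 :: complex and H :: "frac_elt set"
  assumes "coughlan_member \<alpha> l l1 l2 l3 l4 H"
  shows "\<exists>\<alpha>' l1' l2' l3' l4' H'. coughlan_member \<alpha>' 1 l1' l2' l3' l4' H' \<and>
           isomorphic_varieties (coughlan_X \<alpha> l l1 l2 l3 l4 H) (coughlan_X \<alpha>' 1 l1' l2' l3' l4' H')"
proof -
  define J where "J = ideal_FG \<alpha> l l1 l2 l3 l4"
  \<comment> \<open>The new parameters are dictated by \<open>rescale_poly_F_G\<close>, while
    \<alpha> is kept.\<close>
  define J' where "J' = ideal_FG \<alpha> 1 (l\<^sup>2 * l1) (l ^ 3 * l2) (l\<^sup>2 * l3) (l * l4)"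
  have l: "l \<noteq> 0" and gen: "generators6_exist \<alpha> l" and J: "primeideal J ring_R"
    and lifts: "\<exists>ys. unprojection_lifts \<alpha> l J ys" and dim: "anti_invariants2_dim3 \<alpha> l J"
    and H: "H \<in> plane_of_anti_invariants \<alpha> l J"
    using assms by (simp_all add: coughlan_member_def coughlan_general_def Let_def J_def)
  have rel: "rel_set (rescale_rel l) J J'"
    unfolding J_def J'_def by (rule ideal_FG_rescale[OF l gen])
  note params = l rel J lifts
  have bi: "bi_unique (frac_rel l)" "bi_total (frac_rel l)"
    by (intro bi_unique_rel_set prod.bi_unique_rel bi_unique_rescale_rel
        bi_total_rel_set prod.bi_total_rel bi_total_rescale_rel l)+
  \<comment> \<open>The points of \<open>X\<close> are orbits of points of \<open>Y\<close>, hence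
    one more \<open>rel_set\<close> than in \<open>point_rel\<close>.\<close>
  have bi_points: "bi_unique (rel_set (point_rel l))" "bi_total (rel_set (point_rel l))"
    by (intro bi_unique_rel_set bi_total_rel_set bi_unique_fun bi_total_fun bi bi_unique_eq bi_total_eq)+
  have "rel_set (rel_set (frac_rel l)) (plane_of_anti_invariants \<alpha> l J) (plane_of_anti_invariants \<alpha> 1 J')"
    using plane_of_anti_invariants_transfer[OF params] by (simp add: rel_fun_def only_def)
  \<comment> \<open>The two planes of anti-invariants are related as sets, so the point
    \<open>H\<close> has a partner \<open>H'\<close> in the second plane.\<close>
  then obtain H' where H': "H' \<in> plane_of_anti_invariants \<alpha> 1 J'" and HH': "rel_set (frac_rel l) H H'"
    using H unfolding rel_set_def[of "rel_set (frac_rel l)"] by blast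
  have "anti_invariants2_dim3 \<alpha> 1 J'"
    using dim anti_invariants2_dim3_transfer[OF params] by (simp add: rel_fun_def only_def)
  then have general: "coughlan_general \<alpha> 1 (l\<^sup>2 * l1) (l ^ 3 * l2) (l\<^sup>2 * l3) (l * l4)"
    using generator6_rescale(2)[OF l gen] rescaled_ideal_prime[OF params] rescaled_lifts_exist[OF params]
    by (simp add: coughlan_general_def Let_def J'_def)
  have Y: "coughlan_Y \<alpha> l l1 l2 l3 l4 H = surface_Y \<alpha> l J H"
    "coughlan_Y \<alpha> 1 (l\<^sup>2 * l1) (l ^ 3 * l2) (l\<^sup>2 * l3) (l * l4) H' = surface_Y \<alpha> 1 J' H'"
    by (simp_all add: coughlan_Y_def surface_Y_def J_def J'_def)
  have "coughlan_member \<alpha> 1 (l\<^sup>2 * l1) (l ^ 3 * l2) (l\<^sup>2 * l3) (l * l4) H'"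
  proof -
    note iff = member_conditions_transfer[OF params, THEN rel_funD, OF only_self, THEN rel_funD, OF only_self,
        THEN rel_funD, OF only_self, THEN rel_funD, OF HH']
    show ?thesis
      using assms iff general H' unfolding coughlan_member_def Let_def Y J_def[symmetric] J'_def[symmetric]
      by blast
  qed
  moreover have "rel_variety (rel_set (point_rel l)) (coughlan_X \<alpha> l l1 l2 l3 l4 H)
      (coughlan_X \<alpha> 1 (l\<^sup>2 * l1) (l ^ 3 * l2) (l\<^sup>2 * l3) (l * l4) H')"
    using surface_X_transfer[OF params, THEN rel_funD, OF only_self, THEN rel_funD, OF only_self,
        THEN rel_funD, OF only_self, THEN rel_funD, OF HH']
    unfolding coughlan_X_def Y J_def[symmetric] J'_def[symmetric] .
  then have "isomorphic_varieties (coughlan_X \<alpha> l l1 l2 l3 l4 H)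
      (coughlan_X \<alpha> 1 (l\<^sup>2 * l1) (l ^ 3 * l2) (l\<^sup>2 * l3) (l * l4) H')"
    by (rule rel_variety_imp_isomorphic[OF bi_points])
  ultimately show ?thesis by blast
qed

end
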